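(* As $n\to\infty$, \[ S_n\sim \frac{N_n}{n}\exp\left(\sum_{k=1}^\infty\frac{N_k}{k4^k}\right), \] that is, the ratio of the two sides tends to $1$.
   Context: A tournament on the complete graph $K_n$ (vertex set $\{1,\dots,n\}$) is an orientation of each of its edges; an edge directed from $i$ to $j$ means $j$ beats $i$. The score of a vertex is its in-degree (its number of wins). The score sequence of a tournament is the list of the $n$ scores sorted in non-decreasing order. $S_n$ denotes the number of distinct score sequences arising from tournaments on $K_n$ (with $S_0=1$). For $n\ge1$, $N_n$ denotes the number of $n$-element subsets of $\{1,2,\ldots,2n-1\}$ whose elements sum to a multiple of $n$. *)

theory Defs
  imports Complex_Main "HOL-Library.Landau_Symbols"
begin

text \<open>
  A tournament is given by the set \<open>A\<close> of its directed edges; \<open>(i, j) \<in> A\<close> is the edge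
  directed from \<open>i\<close> to \<open>j\<close>, meaning that \<open>j\<close> beats \<open>i\<close>.
\<close>

definition tournament :: "nat \<Rightarrow> (nat \<times> nat) set \<Rightarrow> bool" where
  "tournament n A \<longleftrightarrow>
     A \<subseteq> {1..n} \<times> {1..n} \<and> irrefl A \<and>
     (\<forall>i\<in>{1..n}. \<forall>j\<in>{1..n}. i \<noteq> j \<longrightarrow> ((i, j) \<in> A \<longleftrightarrow> (j, i) \<notin> A))"

definition score :: "(nat \<times> nat) set \<Rightarrow> nat \<Rightarrow> nat" where
  "score A j = card {i. (i, j) \<in> A}"

definition score_sequence :: "nat \<Rightarrow> (nat \<times> nat) set \<Rightarrow> nat list" where
  "score_sequence n A = sort (map (score A) [1..<Suc n])"

definition S :: "nat \<Rightarrow> nat" where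
  "S n = card {score_sequence n A | A. tournament n A}"

definition N :: "nat \<Rightarrow> nat" where
  "N n = card {X. X \<subseteq> {1..2 * n - 1} \<and> card X = n \<and> n dvd \<Sum>X}"

lemma finite_score_sequences: "finite {score_sequence n A | A. tournament n A}"
proof (rule finite_subset)
  show "{score_sequence n A | A. tournament n A}
          \<subseteq> score_sequence n ` Pow ({1..n} \<times> {1..n})"
    by (auto simp: tournament_def)
qed simp

lemma S_0: "S 0 = 1"
proof -
  have "{score_sequence 0 A | A. tournament 0 A} = {[]}"
    by (auto simp: score_sequence_def tournament_def irrefl_def)
  then show ?thesis
    by (simp add: S_def)
qed

end

theory Submission
  imports Defs "HOL-Analysis.Analysis" "HOL-Real_Asymp.Real_Asymp"
begin

text \<open>
  By Landau's theorem the score sequences correspond to the integer excursions with steps at least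
  \<open>-1\<close>. Such an excursion of length \<open>n\<close> with a marked step is split at the first return to \<open>0\<close>
  after the mark; rotating the first part at the mark gives an arbitrary cyclic walk, and the cyclic
  walks of length \<open>k\<close> are counted by \<open>N k\<close>. Hence \<open>n S\<^sub>n = \<Sum>\<^sub>k N\<^sub>k S\<^sub>n\<^sub>-\<^sub>k\<close>. A root of unity filter
  shows that \<open>N\<^sub>n\<close> is \<open>C(2n, n) / (2 n)\<close> up to an error of at most \<open>2\<^sup>n\<close>, so \<open>N\<^sub>n / 4\<^sup>n\<close> is asymptotic
  to a multiple of \<open>n\<^sup>-\<^sup>3\<^sup>/\<^sup>2\<close>. For weights of this kind the recurrence is dominated by its terms with
  \<open>k\<close> close to \<open>n\<close>, which contribute \<open>N\<^sub>n / n\<close> times the total mass \<open>\<Sum>\<^sub>j S\<^sub>j / 4\<^sup>j\<close>, and that mass is the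
  exponential because the recurrence is the differential equation \<open>x f' = B f\<close> of generating functions.
\<close>

section \<open>Landau's theorem\<close>

lemma tournament_subset: "tournament n A \<Longrightarrow> A \<subseteq> {1..n} \<times> {1..n}"
  unfolding tournament_def by blast

lemma tournament_irrefl: "tournament n A \<Longrightarrow> (i, i) \<notin> A"
  unfolding tournament_def irrefl_def by blast

lemma tournament_asym: "tournament n A \<Longrightarrow> (i, j) \<in> A \<Longrightarrow> (j, i) \<notin> A"
  unfolding tournament_def irrefl_def by (cases "i = j") blast+

lemma finite_in_neighbours: "tournament n A \<Longrightarrow> finite {i. (i, j) \<in> A}"
  by (rule finite_subset[of _ "{1..n}"]) (use tournament_subset in fastforce, simp)

text \<open>\<open>U \<times> U\<close> is the disjoint union of the edges inside \<open>U\<close>,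
  their reversals and the diagonal, so
  \<open>card U * card U = 2 * card ?E + card U\<close>.\<close>

lemma card_edges_within:
  assumes "tournament n A" "U \<subseteq> {1..n}"
  shows "card (A \<inter> U \<times> U) = card U choose 2"
proof -
  let ?E = "A \<inter> U \<times> U"
  have fU: "finite U" using assms(2) finite_subset by blast
  have fE: "finite ?E" using fU by auto
  let ?D = "(\<lambda>x. (x, x)) ` U"
  note irr = tournament_irrefl[OF assms(1)] and asym = tournament_asym[OF assms(1)]
  have tot: "(i, j) \<in> A \<or> (j, i) \<in> A" if "i \<in> U" "j \<in> U" "i \<noteq> j" for i j
    using assms that unfolding tournament_def by blast
  have split: "U \<times> U = (?E \<union> ?E\<inverse>) \<union> ?D" using tot by force
  have disj: "?E \<inter> ?E\<inverse> = {}" using asym by blast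
  have disj': "(?E \<union> ?E\<inverse>) \<inter> ?D = {}" using irr by blast
  have "card ?D = card U" by (rule card_image) (auto simp: inj_on_def)
  moreover have "card (U \<times> U) = card (?E \<union> ?E\<inverse>) + card ?D"
    by (subst split, rule card_Un_disjoint) (use fE fU disj' in auto)
  moreover have "card (?E \<union> ?E\<inverse>) = card ?E + card (?E\<inverse>)"
    using fE disj by (intro card_Un_disjoint) auto
  ultimately have "card U * card U = card ?E + card ?E + card U"
    by (simp add: card_cartesian_product)
  then show ?thesis
    by (simp add: choose_two diff_mult_distrib2)
qed

lemma sum_score:
  assumes "tournament n A" "U \<subseteq> {1..n}"
  shows "(\<Sum>j\<in>U. score A j) = card (A \<inter> UNIV \<times> U)"
proof -
  have fU: "finite U" using assms(2) finite_subset by blast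
  have "A \<inter> UNIV \<times> U = (\<lambda>(x, y). (y, x)) ` (SIGMA j:U. {i. (i, j) \<in> A})"
    by force
  then have "card (A \<inter> UNIV \<times> U) = card (SIGMA j:U. {i. (i, j) \<in> A})"
    by (simp add: card_image inj_on_def split_def prod_eq_iff)
  also have "\<dots> = (\<Sum>j\<in>U. score A j)"
    using fU finite_in_neighbours[OF assms(1)] by (simp add: score_def)
  finally show ?thesis by simp
qed

text \<open>The edges inside \<open>U\<close> are among the edges with head in \<open>U\<close>, and
  the latter are counted by the scores.\<close>

lemma sum_score_ge:
  assumes "tournament n A" "U \<subseteq> {1..n}"
  shows "card U choose 2 \<le> (\<Sum>j\<in>U. score A j)"
proof -
  have "finite A" using tournament_subset[OF assms(1)] by (rule finite_subset) simp
  then have "card (A \<inter> U \<times> U) \<le> card (A \<inter> UNIV \<times> U)"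
    by (intro card_mono) auto
  then show ?thesis using card_edges_within[OF assms] sum_score[OF assms] by simp
qed

lemma sum_score_all:
  assumes "tournament n A"
  shows "(\<Sum>j\<in>{1..n}. score A j) = n choose 2"
proof -
  have "A \<inter> UNIV \<times> {1..n} = A \<inter> {1..n} \<times> {1..n}"
    using tournament_subset[OF assms] by blast
  then show ?thesis using card_edges_within[OF assms] sum_score[OF assms] by simp
qed

section \<open>Landau's conditions and their necessity\<close>

text \<open>Constraining the prefixes is enough: in a sorted list the first \<open>k\<close> entries
  have the least sum among all choices of \<open>k\<close> entries.\<close>

definition landau :: "nat list \<Rightarrow> bool" where
  "landau s \<longleftrightarrow> sorted s \<and> (\<forall>k\<le>length s. k choose 2 \<le> sum_list (take k s)) \<and>
     sum_list s = length s choose 2"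

lemma sort_map_conv_sort_key: "sort (map f xs) = map f (sort_key f xs)"
  by (rule properties_for_sort) (auto simp: sorted_sort_key)

text \<open>Sorting the vertices by score, instead of the bare scores, turns each prefix of the
  sequence into a sum over a set of vertices, to which \<open>sum_score_ge\<close> applies.\<close>

lemma landau_score_sequence:
  assumes "tournament n A"
  shows "landau (score_sequence n A)" "length (score_sequence n A) = n"
proof -
  define ys where "ys = sort_key (score A) [1..<Suc n]"
  have ss: "score_sequence n A = map (score A) ys"
    by (simp only: score_sequence_def ys_def sort_map_conv_sort_key)
  have ys: "distinct ys" "set ys = {1..n}" "length ys = n"
    by (auto simp: ys_def)
  show len: "length (score_sequence n A) = n" using ss ys by simp
  have eq: "sum_list (take k (score_sequence n A)) = (\<Sum>j\<in>set (take k ys). score A j)" for k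
    using ys by (simp add: ss take_map sum_list_distinct_conv_sum_set)
  have "k choose 2 \<le> sum_list (take k (score_sequence n A))" if "k \<le> n" for k
  proof -
    have "card (set (take k ys)) = k" using ys that by (simp add: distinct_card)
    moreover have "set (take k ys) \<subseteq> {1..n}" using ys(2) set_take_subset by metis
    ultimately show ?thesis using sum_score_ge[OF assms] eq by metis
  qed
  moreover have "sum_list (score_sequence n A) = n choose 2"
    using eq[of n] ys len sum_score_all[OF assms] by simp
  ultimately show "landau (score_sequence n A)"
    using len by (simp add: landau_def score_sequence_def)
qed

section \<open>Edge reversals and the sufficiency of Landau's conditions\<close>

lemma reverse_edge:
  assumes "tournament n A" "(x, y) \<in> A"
  defines "A' \<equiv> A - {(x, y)} \<union> {(y, x)}"
  shows "tournament n A'" "score A' x = Suc (score A x)" "Suc (score A' y) = score A y"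
    "u \<noteq> x \<Longrightarrow> u \<noteq> y \<Longrightarrow> score A' u = score A u"
proof -
  have xy: "x \<noteq> y" "x \<in> {1..n}" "y \<in> {1..n}" "(y, x) \<notin> A"
    using assms(1,2) tournament_irrefl[OF assms(1), of x] tournament_asym[OF assms(1,2)]
      tournament_subset[OF assms(1)] by auto
  show "tournament n A'"
    unfolding tournament_def
  proof (intro conjI ballI impI)
    show "A' \<subseteq> {1..n} \<times> {1..n}" using tournament_subset[OF assms(1)] xy by (auto simp: A'_def)
    show "irrefl A'" using tournament_irrefl[OF assms(1)] xy by (auto simp: A'_def irrefl_def)
    fix i j assume "i \<in> {1..n}" "j \<in> {1..n}" "i \<noteq> j"
    then have "(i, j) \<in> A \<longleftrightarrow> (j, i) \<notin> A" using assms(1) unfolding tournament_def by blast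
    moreover have "(k, l) \<in> A' \<longleftrightarrow> (k = y \<and> l = x) \<or> (k, l) \<in> A \<and> \<not> (k = x \<and> l = y)" for k l
      by (auto simp: A'_def)
    ultimately show "(i, j) \<in> A' \<longleftrightarrow> (j, i) \<notin> A'" using xy assms(2) by metis
  qed
  have "{i. (i, x) \<in> A'} = insert y {i. (i, x) \<in> A}" using xy by (auto simp: A'_def)
  then show "score A' x = Suc (score A x)"
    using xy finite_in_neighbours[OF assms(1)] by (simp add: score_def)
  have "{i. (i, y) \<in> A} = insert x {i. (i, y) \<in> A'}" "(x, y) \<notin> A'"
    using xy(1,4) assms(2) by (auto simp: A'_def)
  then show "Suc (score A' y) = score A y"
    using finite_in_neighbours[OF \<open>tournament n A'\<close>] by (simp add: score_def)
  show "u \<noteq> x \<Longrightarrow> u \<noteq> y \<Longrightarrow> score A' u = score A u"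
    by (simp add: score_def A'_def)
qed

text \<open>A vertex of smaller score reaches one of larger score by a path of length at most two;
  reversing that path transfers one unit of score.\<close>

lemma transfer_score:
  assumes "tournament n A" "v \<in> {1..n}" "w \<in> {1..n}" "score A v < score A w"
  obtains A' where "tournament n A'" "score A' v = Suc (score A v)" "Suc (score A' w) = score A w"
    "\<And>u. u \<noteq> v \<Longrightarrow> u \<noteq> w \<Longrightarrow> score A' u = score A u"
proof (cases "(v, w) \<in> A")
  case True
  from that[OF reverse_edge[OF assms(1) True]] show ?thesis by blast
next
  case False
  \<comment> \<open>By comparing cardinalities, some \<open>x\<close> has an edge to
    \<open>w\<close> but none to \<open>v\<close>; \<open>False\<close> excludes
    \<open>x = v\<close>. This yields the path \<open>v\<close>, \<open>x\<close>, \<open>w\<close>,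
    and reversing both of its edges leaves the score of \<open>x\<close> unchanged.\<close>
  have "\<not> {i. (i, w) \<in> A} \<subseteq> {i. (i, v) \<in> A}"
    using assms(4) card_mono[OF finite_in_neighbours[OF assms(1)]] unfolding score_def
    by (metis linorder_not_less)
  then obtain x where x: "(x, w) \<in> A" "(x, v) \<notin> A" by auto
  with False assms have "x \<noteq> w" "x \<noteq> v" "x \<in> {1..n}"
    using tournament_irrefl[OF assms(1)] tournament_subset[OF assms(1)] by auto
  with x assms have vx: "(v, x) \<in> A" unfolding tournament_def by blast
  have vw: "v \<noteq> w" using assms(4) by auto
  note 1 = reverse_edge[OF assms(1) vx]
  have xw: "(x, w) \<in> A - {(v, x)} \<union> {(x, v)}" using x \<open>x \<noteq> v\<close> by auto
  note 2 = reverse_edge[OF 1(1) xw]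
  show ?thesis
    by (rule that[OF 2(1)]) (use 1 2 vw \<open>x \<noteq> w\<close> \<open>x \<noteq> v\<close> in \<open>(metis Suc_inject)+\<close>)
qed

text \<open>The starting point of the extremal argument below: its prefix sums are
  \<open>k choose 2\<close>, the least that Landau's inequalities allow.\<close>

lemma transitive_tournament:
  fixes n :: nat
  defines "A \<equiv> {(i, j). i \<in> {1..n} \<and> j \<in> {1..n} \<and> i < j}"
  shows "tournament n A" "j \<in> {1..n} \<Longrightarrow> score A j = j - 1"
proof -
  show "tournament n A" by (auto simp: A_def tournament_def irrefl_def)
  assume "j \<in> {1..n}"
  then have "{i. (i, j) \<in> A} = {1..<j}" by (auto simp: A_def)
  then show "score A j = j - 1" by (simp add: score_def)
qed

lemma sum_pred_eq_choose_two: "(\<Sum>j\<in>{1..k}. j - 1) = k choose 2"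
  by (induction k) (auto simp: numeral_2_eq_2)

text \<open>Among the tournaments whose scores have prefix sums at most those of \<open>f\<close>, one that
  maximizes the total of the prefix sums has scores \<open>f\<close>: otherwise a transfer of score between
  the ends of a maximal interval of strict inequality would increase that total.\<close>

lemma tournament_with_scores:
  fixes f :: "nat \<Rightarrow> nat"
  assumes mono: "\<And>i j. 1 \<le> i \<Longrightarrow> i \<le> j \<Longrightarrow> j \<le> n \<Longrightarrow> f i \<le> f j"
    and ge: "\<And>k. k \<le> n \<Longrightarrow> k choose 2 \<le> (\<Sum>j\<in>{1..k}. f j)"
    and eq: "(\<Sum>j\<in>{1..n}. f j) = n choose 2"
  obtains A where "tournament n A" "\<And>j. j \<in> {1..n} \<Longrightarrow> score A j = f j"
proof -
  define F where "F k = (\<Sum>j\<in>{1..k}. f j)" for k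
  define T where "T A k = (\<Sum>j\<in>{1..k}. score A j)" for A k
  define good where "good A \<longleftrightarrow> tournament n A \<and> (\<forall>k\<le>n. T A k \<le> F k)" for A
  define W where "W A = (\<Sum>k\<in>{1..n}. T A k)" for A
  have "good {(i, j). i \<in> {1..n} \<and> j \<in> {1..n} \<and> i < j}"
    unfolding good_def
  proof (intro conjI allI impI)
    fix k assume "k \<le> n"
    then have "T {(i, j). i \<in> {1..n} \<and> j \<in> {1..n} \<and> i < j} k = (\<Sum>j\<in>{1..k}. j - 1)"
      unfolding T_def by (intro sum.cong refl transitive_tournament) auto
    then show "T {(i, j). i \<in> {1..n} \<and> j \<in> {1..n} \<and> i < j} k \<le> F k"
      using ge[OF \<open>k \<le> n\<close>] by (simp only: sum_pred_eq_choose_two F_def)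
  qed (rule transitive_tournament)
  moreover have "W A \<le> (\<Sum>k\<in>{1..n}. F k)" if "good A" for A
    using that unfolding W_def good_def by (intro sum_mono) auto
  then have "\<forall>A. good A \<longrightarrow> W A < Suc (\<Sum>k\<in>{1..n}. F k)" by (simp add: less_Suc_eq_le)
  ultimately obtain A where A: "good A" and max: "\<And>B. good B \<Longrightarrow> W B \<le> W A"
    using ex_has_greatest_nat[of good _ W "Suc (\<Sum>k\<in>{1..n}. F k)"] by blast
  have tA: "tournament n A" and le: "\<And>k. k \<le> n \<Longrightarrow> T A k \<le> F k" using A by (auto simp: good_def)
  have Tn: "T A n = F n" using sum_score_all[OF tA] eq by (simp add: T_def F_def)
  have T0: "T A 0 = F 0" by (simp add: T_def F_def)
  have Suc_T: "T B (Suc k) = T B k + score B (Suc k)" for B k by (simp add: T_def)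
  have Suc_F: "F (Suc k) = F k + f (Suc k)" for k by (simp add: F_def)
  have all_eq: "T A k = F k" if "k \<le> n" for k
  proof (rule ccontr)
    assume "T A k \<noteq> F k"
    define l where "l = (LEAST k. T A k \<noteq> F k)"
    have l: "T A l \<noteq> F l" "l \<le> k" 
      unfolding l_def using \<open>T A k \<noteq> F k\<close> by (rule LeastI, rule Least_le)
    have l_min: "T A i = F i" if "i < l" for i using that not_less_Least l_def by blast
    have "l \<noteq> n" "l \<noteq> 0" using l Tn T0 by metis+
    with l \<open>k \<le> n\<close> have ln: "1 \<le> l" "l < n" by auto
    define m where "m = (LEAST m. l < m \<and> T A m = F m)"
    have m: "l < m" "T A m = F m" "m \<le> n"
      unfolding m_def using LeastI[of "\<lambda>m. l < m \<and> T A m = F m" n] Least_le[of "\<lambda>m. l < m \<and> T A m = F m" n]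
        ln Tn by auto
    have m_min: "T A i < F i" if "l \<le> i" "i < m" for i
    proof -
      have "T A i \<noteq> F i" using that not_less_Least[of i "\<lambda>m. l < m \<and> T A m = F m"] l
        by (cases "i = l") (auto simp: m_def[symmetric])
      with le[of i] that m show ?thesis by simp
    qed
    obtain l' where l': "l = Suc l'" using ln by (cases l) auto
    obtain m' where m': "m = Suc m'" using m by (cases m) auto
    \<comment> \<open>Equality just before \<open>l\<close> and strictness at \<open>l\<close> make
      the score of \<open>l\<close> too small; strictness just before \<open>m\<close> and equality
      at \<open>m\<close> make the score of \<open>m\<close> too large. Monotonicity of
      \<open>f\<close> then orders the two scores.\<close>
    have "score A l < f l" using l_min[of l'] m_min[of l] m Suc_T[of A l'] Suc_F[of l'] l' by simp
    moreover have "f m < score A m"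
      using m_min[of m'] m Suc_T[of A m'] Suc_F[of m'] m' by simp
    moreover have "f l \<le> f m" using mono[of l m] ln m by simp
    ultimately have "score A l < score A m" by simp
    moreover have "l \<in> {1..n}" "m \<in> {1..n}" using ln m by auto
    ultimately obtain B where B: "tournament n B" "score B l = Suc (score A l)"
        "Suc (score B m) = score A m" "\<And>u. u \<noteq> l \<Longrightarrow> u \<noteq> m \<Longrightarrow> score B u = score A u"
      using transfer_score[OF tA] by metis
    \<comment> \<open>The transfer raises by one exactly the prefix sums from \<open>l\<close> to
      \<open>m - 1\<close>, and all of these were strictly below \<open>F\<close>.\<close>
    have TB: "T B i = T A i + (if l \<le> i \<and> i < m then 1 else 0)" for i
    proof (induction i)
      case (Suc i)
      consider "Suc i = l" | "Suc i = m" | "Suc i \<noteq> l" "Suc i \<noteq> m" by blast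
      then show ?case
        using Suc B(2,3) B(4)[of "Suc i"] \<open>l < m\<close> by cases (auto simp: Suc_T)
    qed (use ln in \<open>auto simp: T_def\<close>)
    have "good B" using B(1) TB le m_min by (auto simp: good_def Suc_le_eq)
    moreover have "W A < W B"
      unfolding W_def by (rule sum_strict_mono_ex1) (use TB m ln in \<open>auto intro!: bexI[of _ l]\<close>)
    ultimately show False using max by (simp add: leD)
  qed
  have "score A j = f j" if j: "j \<in> {1..n}" for j
  proof -
    obtain i where "j = Suc i" using j by (cases j) auto
    then show ?thesis using all_eq[of i] all_eq[of j] j Suc_T[of A i] Suc_F[of i] by simp
  qed
  with tA that show thesis by blast
qed

lemma sum_list_take_conv_sum: "k \<le> length s \<Longrightarrow> sum_list (take k s) = (\<Sum>j\<in>{1..k}. s ! (j - 1))"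
  by (induction k) (auto simp: take_Suc_conv_app_nth)

lemma landau_imp_score_sequence:
  assumes "landau s" "length s = n"
  obtains A where "tournament n A" "score_sequence n A = s"
proof -
  obtain A where A: "tournament n A" "\<And>j. j \<in> {1..n} \<Longrightarrow> score A j = s ! (j - 1)"
  proof (rule tournament_with_scores[where n = n and f = "\<lambda>j. s ! (j - 1)"])
    show "s ! (i - 1) \<le> s ! (j - 1)" if "1 \<le> i" "i \<le> j" "j \<le> n" for i j
      using assms that by (auto simp: landau_def intro!: sorted_nth_mono)
    show "k choose 2 \<le> (\<Sum>j = 1..k. s ! (j - 1))" if "k \<le> n" for k
      using assms that sum_list_take_conv_sum[of k s] by (auto simp: landau_def)
    show "(\<Sum>j = 1..n. s ! (j - 1)) = n choose 2"
      using assms sum_list_take_conv_sum[of n s] by (auto simp: landau_def)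
  qed blast
  have "map (score A) [1..<Suc n] = s"
    using A(2) assms(2) by (intro nth_equalityI) (auto simp del: upt_Suc)
  then have "score_sequence n A = s"
    using assms(1) by (simp only: score_sequence_def landau_def sorted_sort_id)
  with A(1) that show thesis by blast
qed

theorem S_eq_card_landau: "S n = card {s. landau s \<and> length s = n}"
proof -
  have "{score_sequence n A | A. tournament n A} = {s. landau s \<and> length s = n}"
    using landau_score_sequence landau_imp_score_sequence by (fastforce elim: landau_imp_score_sequence)
  then show ?thesis by (simp add: S_def)
qed

section \<open>Excursions and cyclic walks\<close>

definition psum :: "int list \<Rightarrow> nat \<Rightarrow> int" where
  "psum xs k = sum_list (take k xs)"

lemma psum_0 [simp]: "psum xs 0 = 0"
  by (simp add: psum_def)

lemma psum_ge_length: "length xs \<le> k \<Longrightarrow> psum xs k = sum_list xs"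
  by (simp add: psum_def)

lemma psum_Suc: "k < length xs \<Longrightarrow> psum xs (Suc k) = psum xs k + xs ! k"
  by (simp add: psum_def take_Suc_conv_app_nth)

lemma psum_append: "psum (xs @ ys) k = (if k \<le> length xs then psum xs k else sum_list xs + psum ys (k - length xs))"
  by (simp add: psum_def)

lemma psum_add: "psum xs (m + j) = psum xs m + psum (drop m xs) j"
  by (simp add: psum_def take_add)

lemma psum_conv_sum: "k \<le> length xs \<Longrightarrow> psum xs k = (\<Sum>i<k. xs ! i)"
  by (induction k) (auto simp: psum_Suc)

text \<open>Subtracting \<open>0, 1, 2, \<dots>\<close> from a score sequence gives an excursion: monotonicity turns into
  steps of at least \<open>-1\<close>, and Landau's inequalities into nonnegative prefix sums.\<close>

definition excursions :: "nat \<Rightarrow> int list set" where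
  "excursions n = {xs. length xs = n \<and> (\<forall>i. Suc i < n \<longrightarrow> xs ! i - 1 \<le> xs ! Suc i) \<and>
     sum_list xs = 0 \<and> (\<forall>k\<le>n. 0 \<le> psum xs k)}"

text \<open>The step condition also runs from the last entry back to the first, and no sign
  condition is imposed on prefix sums. This makes the set closed under rotation.\<close>

definition cyclic_walks :: "nat \<Rightarrow> int list set" where
  "cyclic_walks n = {xs. length xs = n \<and> (\<forall>i<n. xs ! i - 1 \<le> xs ! (Suc i mod n)) \<and> sum_list xs = 0}"

text \<open>The first entry is itself a prefix sum, hence nonnegative, and each step loses at most
  \<open>1\<close>. Adding \<open>i\<close> back therefore gives natural numbers, as the inverse of
  the bijection with score sequences requires.\<close>

lemma excursion_nth_ge:
  assumes "xs \<in> excursions n" "i < n"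
  shows "- int i \<le> xs ! i"
  using assms(2)
proof (induction i)
  case 0
  have len: "length xs = n" and ge: "\<forall>k\<le>n. 0 \<le> psum xs k" using assms(1) by (auto simp: excursions_def)
  have "0 \<le> psum xs 1" using 0 ge by (simp add: Suc_leI)
  moreover have "psum xs 1 = xs ! 0" using 0 len psum_Suc[of 0 xs] by simp
  ultimately show ?case by simp
next
  case (Suc i)
  have "xs ! i - 1 \<le> xs ! Suc i" using assms(1) Suc.prems by (simp add: excursions_def)
  with Suc show ?case by simp
qed

lemma sum_nat_eq_choose_two: "(\<Sum>i<k. int i) = int (k choose 2)"
  by (induction k) (auto simp: numeral_2_eq_2)

lemma landau_iff_excursion:
  "landau s \<longleftrightarrow> map (\<lambda>i. int (s ! i) - int i) [0..<length s] \<in> excursions (length s)"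
proof -
  define n where "n = length s"
  define x where "x = map (\<lambda>i. int (s ! i) - int i) [0..<n]"
  have len: "length x = n" by (simp add: x_def)
  have nth: "x ! i = int (s ! i) - int i" if "i < n" for i using that by (simp add: x_def)
  have tk: "sum_list (take k s) = (\<Sum>i<k. s ! i)" if "k \<le> n" for k
    using that by (induction k) (auto simp: n_def take_Suc_conv_app_nth)
  have ps: "psum x k = int (sum_list (take k s)) - int (k choose 2)" if "k \<le> n" for k
    using that by (simp add: psum_conv_sum len nth tk sum_subtractf flip: sum_nat_eq_choose_two)
  have "sum_list x = psum x n" "sum_list s = sum_list (take n s)"
    using psum_ge_length[of x n] len by (simp_all add: n_def)
  then have tot: "sum_list x = int (sum_list s) - int (n choose 2)"
    using ps[of n] by simp
  have "sorted s \<longleftrightarrow> (\<forall>i. Suc i < n \<longrightarrow> x ! i - 1 \<le> x ! Suc i)"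
    unfolding sorted_iff_nth_Suc n_def[symmetric] using nth by auto
  then show ?thesis
    unfolding landau_def excursions_def using ps tot len by (auto simp: x_def[symmetric] n_def[symmetric])
qed

lemma bij_betw_landau_excursions:
  "bij_betw (\<lambda>s. map (\<lambda>i. int (s ! i) - int i) [0..<n]) {s. landau s \<and> length s = n} (excursions n)"
proof (rule bij_betwI[where g = "\<lambda>x. map (\<lambda>i. nat (x ! i + int i)) [0..<n]"])
  show "(\<lambda>s. map (\<lambda>i. int (s ! i) - int i) [0..<n]) \<in> {s. landau s \<and> length s = n} \<rightarrow> excursions n"
    using landau_iff_excursion by auto
  have inv: "map (\<lambda>i. int (map (\<lambda>i. nat (x ! i + int i)) [0..<n] ! i) - int i) [0..<n] = x"
    if "x \<in> excursions n" for x
  proof (rule nth_equalityI)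
    show "length (map (\<lambda>i. int (map (\<lambda>i. nat (x ! i + int i)) [0..<n] ! i) - int i) [0..<n]) = length x"
      using that by (simp add: excursions_def)
  qed (use excursion_nth_ge[OF that] in force)
  then show "(\<lambda>x. map (\<lambda>i. nat (x ! i + int i)) [0..<n]) \<in> excursions n \<rightarrow> {s. landau s \<and> length s = n}"
    by (auto simp: landau_iff_excursion simp del: map_eq_conv)
  show "map (\<lambda>i. int (map (\<lambda>i. nat (y ! i + int i)) [0..<n] ! i) - int i) [0..<n] = y"
    if "y \<in> excursions n" for y by (rule inv[OF that])
  show "map (\<lambda>i. nat (map (\<lambda>i. int (x ! i) - int i) [0..<n] ! i + int i)) [0..<n] = x"
    if "x \<in> {s. landau s \<and> length s = n}" for x
    using that by (intro nth_equalityI) auto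
qed

lemma S_eq_card_excursions: "S n = card (excursions n)"
  using bij_betw_same_card[OF bij_betw_landau_excursions] by (simp add: S_eq_card_landau)

lemma finite_excursions: "finite (excursions n)"
proof -
  have "{s. landau s \<and> length s = n} \<subseteq> {score_sequence n A | A. tournament n A}"
    using landau_imp_score_sequence by fastforce
  then have "finite {s. landau s \<and> length s = n}"
    using finite_score_sequences by (rule finite_subset)
  then show ?thesis using bij_betw_finite[OF bij_betw_landau_excursions] by blast
qed

section \<open>Decomposition of excursions at their returns to zero\<close>

text \<open>The prefix sums are zero at both ends and nonnegative next to them. Hence the step from
  the end of one excursion to the start of another, or back to its own start, never goes
  down.\<close>

lemma excursion_hd_last:
  assumes "xs \<in> excursions n" "0 < n"
  shows "0 \<le> xs ! 0" "xs ! (n - 1) \<le> 0"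
proof -
  show "0 \<le> xs ! 0" using excursion_nth_ge[OF assms(1), of 0] assms(2) by simp
  have "psum xs n = psum xs (n - 1) + xs ! (n - 1)"
    using psum_Suc[of "n - 1" xs] assms by (simp add: excursions_def)
  moreover have "psum xs n = 0" "0 \<le> psum xs (n - 1)"
    using assms by (auto simp: excursions_def psum_ge_length)
  ultimately show "xs ! (n - 1) \<le> 0" by simp
qed

text \<open>Excursions with a marked step that lies in the last irreducible component.\<close>

definition marked_excursions :: "nat \<Rightarrow> (int list \<times> nat) set" where
  "marked_excursions k = {(f, i). f \<in> excursions k \<and> i < k \<and> (\<forall>j. i < j \<longrightarrow> j < k \<longrightarrow> psum f j \<noteq> 0)}"

lemma finite_marked_excursions: "finite (marked_excursions k)"
  by (rule finite_subset[of _ "excursions k \<times> {..<k}"])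
    (auto simp: marked_excursions_def finite_excursions)

lemma append_in_excursions:
  assumes "f \<in> excursions k" "g \<in> excursions m"
  shows "f @ g \<in> excursions (k + m)"
proof -
  have f: "length f = k" "sum_list f = 0" and g: "length g = m" "sum_list g = 0"
    using assms by (auto simp: excursions_def)
  have "(f @ g) ! i - 1 \<le> (f @ g) ! Suc i" if "Suc i < k + m" for i
  proof -
    consider "Suc i < k" | "Suc i = k" | "k \<le> i" by linarith
    then show ?thesis
    proof cases
      case 1 then show ?thesis using assms by (simp add: excursions_def nth_append)
    next
      case 2
      then show ?thesis
        using excursion_hd_last[OF assms(1)] excursion_hd_last[OF assms(2)] that f by (auto simp: nth_append)
    next
      case 3 then show ?thesis using assms that by (simp add: excursions_def nth_append Suc_diff_le)
    qed
  qed
  then show ?thesis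
    using assms f g by (auto simp: excursions_def psum_append)
qed

lemma split_excursion:
  assumes "e \<in> excursions n" "k \<le> n" "psum e k = 0"
  shows "take k e \<in> excursions k" "drop k e \<in> excursions (n - k)"
proof -
  have len: "length e = n" and st: "\<And>i. Suc i < n \<Longrightarrow> e ! i - 1 \<le> e ! Suc i"
    and e: "sum_list e = 0" "\<And>j. j \<le> n \<Longrightarrow> 0 \<le> psum e j"
    using assms by (auto simp: excursions_def)
  have 0: "sum_list (take k e) = 0" using assms(3) by (simp add: psum_def)
  have "psum (take k e) j = psum e j" if "j \<le> k" for j
    using that by (simp add: psum_def)
  then show "take k e \<in> excursions k" using len st e 0 assms(2) by (auto simp: excursions_def)
  have "sum_list (take k e) + sum_list (drop k e) = 0"
    using e(1) by (metis append_take_drop_id sum_list_append)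
  moreover have "psum (drop k e) j = psum e (k + j)" for j
    using assms(3) by (simp add: psum_add)
  ultimately show "drop k e \<in> excursions (n - k)" using len st e 0 assms(2) by (auto simp: excursions_def)
qed

text \<open>The cut is recovered from \<open>(f @ g, i)\<close> as the least \<open>k > i\<close> at
  which the prefix sum vanishes.\<close>

lemma bij_betw_split_excursion:
  "bij_betw (\<lambda>(k, (f, i), g). (f @ g, i))
     (SIGMA k:{1..n}. marked_excursions k \<times> excursions (n - k)) (excursions n \<times> {..<n})"
  unfolding bij_betw_def
proof
  have zero: "psum (f @ g) k = 0" "\<And>j. i < j \<Longrightarrow> j < k \<Longrightarrow> psum (f @ g) j \<noteq> 0" "i < k" "length f = k"
    if "(f, i) \<in> marked_excursions k" for f g i k
    using that by (auto simp: marked_excursions_def excursions_def psum_append psum_ge_length)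
  show "inj_on (\<lambda>(k, (f, i), g). (f @ g, i)) (SIGMA k:{1..n}. marked_excursions k \<times> excursions (n - k))"
  proof (rule inj_onI, clarsimp)
    fix k f i g k' f' g'
    assume f: "(f, i) \<in> marked_excursions k" "(f', i) \<in> marked_excursions k'" and eq: "f @ g = f' @ g'"
    have "psum (f @ g) k = 0" "\<And>j. i < j \<Longrightarrow> j < k \<Longrightarrow> psum (f @ g) j \<noteq> 0" "i < k"
      using zero[OF f(1)] by auto
    moreover have "psum (f @ g) k' = 0" "\<And>j. i < j \<Longrightarrow> j < k' \<Longrightarrow> psum (f @ g) j \<noteq> 0" "i < k'"
      using zero[OF f(2)] eq by auto
    ultimately have "k = k'" by (metis linorder_neqE_nat)
    then show "k = k' \<and> f = f' \<and> g = g'"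
      using zero(4)[OF f(1)] zero(4)[OF f(2)] eq by simp
  qed
  show "(\<lambda>(k, (f, i), g). (f @ g, i)) ` (SIGMA k:{1..n}. marked_excursions k \<times> excursions (n - k)) =
      excursions n \<times> {..<n}" (is "?h ` ?X = ?Y")
  proof
    show "?h ` ?X \<subseteq> ?Y"
      using append_in_excursions by (fastforce simp: marked_excursions_def)
    show "?Y \<subseteq> ?h ` ?X"
    proof clarify
      fix e i assume e: "e \<in> excursions n" and i: "i < n"
      define k where "k = (LEAST k. i < k \<and> psum e k = 0)"
      have "psum e n = 0" using e by (simp add: excursions_def psum_ge_length)
      then have k: "i < k" "psum e k = 0" "k \<le> n"
        unfolding k_def using i LeastI[of "\<lambda>k. i < k \<and> psum e k = 0" n]
          Least_le[of "\<lambda>k. i < k \<and> psum e k = 0" n] by auto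
      have "psum e j \<noteq> 0" if "i < j" "j < k" for j
        using that not_less_Least[of j "\<lambda>k. i < k \<and> psum e k = 0"] by (auto simp: k_def)
      then have "(take k e, i) \<in> marked_excursions k"
        using split_excursion[OF e k(3,2)] k by (auto simp: marked_excursions_def psum_def)
      then have "(k, (take k e, i), drop k e) \<in> ?X"
        using split_excursion[OF e k(3,2)] k by auto
      then show "(e, i) \<in> ?h ` ?X" by (rule rev_image_eqI) simp
    qed
  qed
qed

section \<open>Rotation of walks\<close>

lemma sum_list_rotate: "sum_list (rotate m (xs :: int list)) = sum_list xs"
  by (metis rotate_drop_take add.commute append_take_drop_id sum_list_append)

lemma rotate_eq_drop_take: "m \<le> length xs \<Longrightarrow> rotate m xs = drop m xs @ take m xs"
  by (cases "m = length xs") (auto simp: rotate_drop_take)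

text \<open>Rotation by \<open>m\<close> shifts the graph of prefix sums cyclically and lowers it by
  \<open>psum c m\<close>; the two claims treat the indices before and after the wrap.\<close>

lemma psum_rotate:
  assumes "sum_list c = 0" "m \<le> length c"
  shows "j \<le> length c - m \<Longrightarrow> psum (rotate m c) j = psum c (m + j) - psum c m"
    and "j \<le> m \<Longrightarrow> psum (rotate m c) (length c - m + j) = psum c j - psum c m"
proof -
  show "j \<le> length c - m \<Longrightarrow> psum (rotate m c) j = psum c (m + j) - psum c m"
    using assms by (simp add: rotate_eq_drop_take psum_append psum_add)
  have "psum c m + sum_list (drop m c) = 0"
    unfolding psum_def using assms(1) by (metis append_take_drop_id sum_list_append)
  moreover assume j: "j \<le> m"
  moreover from j have "psum (take m c) j = psum c j" by (simp add: psum_def)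
  ultimately show "psum (rotate m c) (length c - m + j) = psum c j - psum c m"
    using assms by (cases "j = 0") (auto simp: rotate_eq_drop_take psum_append psum_ge_length)
qed

lemma rotate_in_cyclic_walks:
  assumes "c \<in> cyclic_walks k" "0 < k"
  shows "rotate m c \<in> cyclic_walks k"
proof -
  have len: "length c = k" using assms by (simp add: cyclic_walks_def)
  have "rotate m c ! i - 1 \<le> rotate m c ! (Suc i mod k)" if "i < k" for i
  proof -
    have "rotate m c ! i = c ! ((m + i) mod k)" "rotate m c ! (Suc i mod k) = c ! (Suc ((m + i) mod k) mod k)"
      using that assms(2) len by (auto simp: nth_rotate mod_simps)
    then show ?thesis using assms by (simp add: cyclic_walks_def)
  qed
  then show ?thesis using assms by (simp add: cyclic_walks_def sum_list_rotate)
qed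

lemma excursions_subset_cyclic_walks:
  assumes "f \<in> excursions k"
  shows "f \<in> cyclic_walks k"
proof -
  have "f ! i - 1 \<le> f ! (Suc i mod k)" if "i < k" for i
  proof (cases "Suc i = k")
    case True
    then show ?thesis using excursion_hd_last[OF assms] that by auto
  next
    case False
    with that show ?thesis using assms by (simp add: excursions_def)
  qed
  then show ?thesis using assms by (simp add: cyclic_walks_def excursions_def)
qed

text \<open>The range starts at \<open>1\<close>: for a walk with zero sum the indices
  \<open>0\<close> and \<open>length c\<close> are the same cut, and leaving out \<open>0\<close>
  puts the mark \<open>k - first_min c\<close> below \<open>k\<close>.\<close>

definition first_min :: "int list \<Rightarrow> nat" where
  "first_min c = (LEAST m. 1 \<le> m \<and> m \<le> length c \<and> (\<forall>j\<in>{1..length c}. psum c m \<le> psum c j))"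

lemma first_min:
  assumes "c \<noteq> []"
  shows "1 \<le> first_min c" "first_min c \<le> length c"
    "\<And>j. j \<le> length c \<Longrightarrow> sum_list c = 0 \<Longrightarrow> psum c (first_min c) \<le> psum c j"
    "\<And>j. 1 \<le> j \<Longrightarrow> j < first_min c \<Longrightarrow> psum c (first_min c) < psum c j"
proof -
  let ?P = "\<lambda>m. 1 \<le> m \<and> m \<le> length c \<and> (\<forall>j\<in>{1..length c}. psum c m \<le> psum c j)"
  define m0 where "m0 = arg_min_on (psum c) {1..length c}"
  have "{1..length c} \<noteq> {}" using assms by (cases c) auto
  then have "?P m0"
    using arg_min_if_finite[of "{1..length c}" "psum c"] arg_min_least[of "{1..length c}" _ "psum c"]
    by (auto simp: m0_def)
  then have P: "?P (first_min c)" unfolding first_min_def by (rule LeastI)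
  then show 1: "1 \<le> first_min c" "first_min c \<le> length c" by blast+
  show "psum c (first_min c) \<le> psum c j" if "j \<le> length c" "sum_list c = 0" for j
  proof (cases "j = 0")
    case True
    have "psum c (length c) = 0" using that by (simp add: psum_ge_length)
    moreover have "psum c (first_min c) \<le> psum c (length c)" using P 1 by auto
    ultimately show ?thesis using True by simp
  qed (use P that in auto)
  show "psum c (first_min c) < psum c j" if j: "1 \<le> j" "j < first_min c" for j
  proof (rule ccontr)
    assume "\<not> ?thesis"
    then have "?P j" using P j by force
    with j show False using not_less_Least[of j ?P] unfolding first_min_def by blast
  qed
qed

lemma first_min_eqI:
  assumes "1 \<le> m" "m \<le> length c" "\<And>j. 1 \<le> j \<Longrightarrow> j \<le> length c \<Longrightarrow> psum c m \<le> psum c j"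
    "\<And>j. 1 \<le> j \<Longrightarrow> j < m \<Longrightarrow> psum c m < psum c j"
  shows "first_min c = m"
  unfolding first_min_def
proof (rule Least_equality)
  fix y assume y: "1 \<le> y \<and> y \<le> length c \<and> (\<forall>j\<in>{1..length c}. psum c y \<le> psum c j)"
  then have "psum c y \<le> psum c m" using assms(1,2) by simp
  with y assms(4)[of y] show "m \<le> y" by (meson leD leI)
qed (use assms in auto)

text \<open>A cyclic walk becomes an excursion when cut at the first minimum of its prefix sums.\<close>

lemma bij_betw_rotate:
  assumes "0 < k"
  shows "bij_betw (\<lambda>(f, i). rotate i f) (marked_excursions k) (cyclic_walks k)"
proof (rule bij_betwI[where g = "\<lambda>c. (rotate (first_min c) c, k - first_min c)"])
  show "(\<lambda>(f, i). rotate i f) \<in> marked_excursions k \<rightarrow> cyclic_walks k"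
    using assms by (auto simp: marked_excursions_def intro: rotate_in_cyclic_walks excursions_subset_cyclic_walks)
  show "(\<lambda>c. (rotate (first_min c) c, k - first_min c)) \<in> cyclic_walks k \<rightarrow> marked_excursions k"
  proof
    fix c assume c: "c \<in> cyclic_walks k"
    then have len: "length c = k" and sm: "sum_list c = 0" by (auto simp: cyclic_walks_def)
    define m where "m = first_min c"
    have "c \<noteq> []" using len assms by auto
    note m = first_min[OF this, folded m_def, unfolded len]
    note ps = psum_rotate[OF sm, unfolded len, OF m(2)]
    have ge: "0 \<le> psum (rotate m c) j" if "j \<le> k" for j
    proof (cases "j \<le> k - m")
      case True
      then show ?thesis using ps(1)[OF True] m(3)[of "m + j"] m(2) sm by simp
    next
      case False
      then have "j = k - m + (j - (k - m))" "j - (k - m) \<le> m" using that m(2) by auto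
      then show ?thesis using ps(2)[of "j - (k - m)"] m(3)[of "j - (k - m)"] m(2) sm by simp
    qed
    have "rotate m c \<in> cyclic_walks k" using c assms by (rule rotate_in_cyclic_walks)
    then have "rotate m c ! i - 1 \<le> rotate m c ! Suc i" if "Suc i < k" for i
      using that unfolding cyclic_walks_def by (metis (mono_tags, lifting) Suc_lessD mem_Collect_eq mod_less)
    then have "rotate m c \<in> excursions k"
      using ge sm len by (simp add: excursions_def sum_list_rotate)
    \<comment> \<open>Positions after the mark come from indices before the first minimum, where the
      prefix sums are strictly larger.\<close>
    moreover have "psum (rotate m c) j \<noteq> 0" if "k - m < j" "j < k" for j
    proof -
      have "1 \<le> j - (k - m)" "j - (k - m) < m" "k - m + (j - (k - m)) = j" using that m(1,2) by linarith+
      then show ?thesis using ps(2)[of "j - (k - m)"] m(4)[of "j - (k - m)"] by simp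
    qed
    ultimately show "(rotate (first_min c) c, k - first_min c) \<in> marked_excursions k"
      using m(1) assms by (auto simp: marked_excursions_def m_def[symmetric])
  qed
  show "(\<lambda>c. (rotate (first_min c) c, k - first_min c)) ((\<lambda>(f, i). rotate i f) x) = x"
    if "x \<in> marked_excursions k" for x
  proof -
    obtain f i where x: "x = (f, i)" by fastforce
    with that have f: "f \<in> excursions k" and i: "i < k" and nz: "\<And>j. i < j \<Longrightarrow> j < k \<Longrightarrow> psum f j \<noteq> 0"
      by (auto simp: marked_excursions_def)
    then have len: "length f = k" and sm: "sum_list f = 0" and ge: "\<And>j. j \<le> k \<Longrightarrow> 0 \<le> psum f j"
      by (auto simp: excursions_def)
    have ps: "j \<le> k - i \<Longrightarrow> psum (rotate i f) j = psum f (i + j) - psum f i"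
      "j \<le> i \<Longrightarrow> psum (rotate i f) (k - i + j) = psum f j - psum f i" for j
      using psum_rotate[OF sm, of i] i len by auto
    \<comment> \<open>The start of \<open>f\<close> moves to position \<open>k - i\<close>. It is a
      minimum there because \<open>f\<close> has nonnegative prefix sums, and the first one because
      these have no zero strictly between the mark and the end.\<close>
    have end_val: "psum (rotate i f) (k - i) = - psum f i"
      using ps(2)[of 0] by simp
    have "first_min (rotate i f) = k - i"
    proof (rule first_min_eqI)
      show "1 \<le> k - i" "k - i \<le> length (rotate i f)" using i len by auto
      show "psum (rotate i f) (k - i) \<le> psum (rotate i f) j" if "j \<le> length (rotate i f)" for j
      proof (cases "j \<le> k - i")
        case True
        then show ?thesis using end_val ps(1)[OF True] ge[of "i + j"] i by simp
      next
        case False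
        then show ?thesis using end_val ps(2)[of "j - (k - i)"] ge[of "j - (k - i)"] that len i by simp
      qed
      show "psum (rotate i f) (k - i) < psum (rotate i f) j" if "1 \<le> j" "j < k - i" for j
      proof -
        have "i + j < k" "i < i + j" using that by auto
        then show ?thesis using end_val ps(1)[of j] ge[of "i + j"] nz[of "i + j"] by simp
      qed
    qed
    then show ?thesis using x i len by (simp add: rotate_rotate)
  qed
  show "(\<lambda>(f, i). rotate i f) (rotate (first_min c) c, k - first_min c) = c" if "c \<in> cyclic_walks k" for c
  proof -
    have "length c = k" "c \<noteq> []" using that assms by (auto simp: cyclic_walks_def)
    then show ?thesis using first_min(2)[of c] by (simp add: rotate_rotate)
  qed
qed

lemma excursion_recurrence:
  "n * card (excursions n) = (\<Sum>k\<in>{1..n}. card (cyclic_walks k) * card (excursions (n - k)))"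
proof -
  have "n * card (excursions n) = card (excursions n \<times> {..<n})"
    by (simp add: card_cartesian_product)
  also have "\<dots> = card (SIGMA k:{1..n}. marked_excursions k \<times> excursions (n - k))"
    using bij_betw_same_card[OF bij_betw_split_excursion] by simp
  also have "\<dots> = (\<Sum>k\<in>{1..n}. card (marked_excursions k \<times> excursions (n - k)))"
    using finite_excursions finite_marked_excursions by (intro card_SigmaI) auto
  also have "\<dots> = (\<Sum>k\<in>{1..n}. card (cyclic_walks k) * card (excursions (n - k)))"
    using bij_betw_same_card[OF bij_betw_rotate] by (intro sum.cong) (auto simp: card_cartesian_product)
  finally show ?thesis .
qed

section \<open>Cyclic walks and subsets with sum divisible by n\<close>

lemma sum_eq_sum_sum_list_nth: "length c = n \<Longrightarrow> sum_list (c :: int list) = (\<Sum>i<n. c ! i)"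
  using psum_conv_sum[of n c] by (simp add: psum_ge_length)

text \<open>Complementation within \<open>{1..2 * n - 1}\<close> preserves divisibility by
  \<open>n\<close>, because all elements together sum to \<open>n * (2 * n - 1)\<close>.\<close>

lemma N_eq_card_complements:
  assumes "0 < n"
  shows "N n = card {Y. Y \<subseteq> {1..2 * n - 1} \<and> card Y = n - 1 \<and> n dvd \<Sum>Y}"
proof -
  let ?I = "{1..2 * n - 1}"
  have tot: "\<Sum>?I = n * (2 * n - 1)"
    using gauss_sum_nat[of "2 * n - 1"] assms by (simp add: atLeast1_atMost_eq_remove0 sum_diff1_nat flip: atMost_atLeast0)
  have compl: "card (?I - X) = 2 * n - 1 - card X" "\<Sum>X + \<Sum>(?I - X) = n * (2 * n - 1)" if "X \<subseteq> ?I" for X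
  proof -
    have "finite X" using that finite_subset by blast
    then show "card (?I - X) = 2 * n - 1 - card X" using that by (simp add: card_Diff_subset)
    show "\<Sum>X + \<Sum>(?I - X) = n * (2 * n - 1)"
      using that sum.subset_diff[OF that, of "\<lambda>x. x"] tot by simp
  qed
  have dvd: "n dvd \<Sum>(?I - X) \<longleftrightarrow> n dvd \<Sum>X" if "X \<subseteq> ?I" for X
    using compl(2)[OF that] by (metis dvd_add_right_iff dvd_triv_left dvd_add_left_iff)
  have "bij_betw (\<lambda>X. ?I - X) {X. X \<subseteq> ?I \<and> card X = n \<and> n dvd \<Sum>X}
      {Y. Y \<subseteq> ?I \<and> card Y = n - 1 \<and> n dvd \<Sum>Y}"
    by (rule bij_betwI[where g = "\<lambda>X. ?I - X"]) (use compl(1) dvd assms in auto)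
  then show ?thesis unfolding N_def by (rule bij_betw_same_card)
qed

text \<open>The values \<open>c\<^sub>i - c\<^sub>0 + 2 i\<close> of a cyclic walk increase strictly from \<open>0\<close> to at most \<open>2 n - 1\<close>.\<close>

definition lift_walk :: "int list \<Rightarrow> nat \<Rightarrow> int" where
  "lift_walk c i = c ! i - c ! 0 + 2 * int i"

lemma cyclic_walk_step: "c \<in> cyclic_walks n \<Longrightarrow> i < n \<Longrightarrow> c ! i - 1 \<le> c ! (Suc i mod n)"
  by (simp add: cyclic_walks_def)

lemma lift_walk_mono:
  assumes "c \<in> cyclic_walks n" "i < j" "j < n"
  shows "lift_walk c i < lift_walk c j"
  using assms(2,3)
proof (induction j)
  case (Suc j)
  have "j < n" using Suc.prems by simp
  then have "c ! j - 1 \<le> c ! (Suc j mod n)" using assms(1) by (simp add: cyclic_walks_def)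
  then have "lift_walk c j < lift_walk c (Suc j)" using Suc.prems by (simp add: lift_walk_def)
  with Suc show ?case by (cases "i = j") auto
qed simp

lemma lift_walk_bounds:
  assumes "c \<in> cyclic_walks n" "1 \<le> i" "i < n"
  shows "lift_walk c i \<in> {1..2 * int n - 1}"
proof -
  have "lift_walk c 0 < lift_walk c i" using lift_walk_mono[OF assms(1), of 0 i] assms by simp
  moreover have "lift_walk c i \<le> lift_walk c (n - 1)"
  proof (cases "i = n - 1")
    case False
    then have "i < n - 1" using assms by simp
    then show ?thesis using lift_walk_mono[OF assms(1), of i "n - 1"] by simp
  qed simp
  \<comment> \<open>The wrap-around step bounds the last entry by \<open>c ! 0 + 1\<close>, whence
    the upper end \<open>1 + 2 * (n - 1)\<close>.\<close>
  moreover have "c ! (n - 1) - 1 \<le> c ! (Suc (n - 1) mod n)"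
    using cyclic_walk_step[OF assms(1), of "n - 1"] assms by simp
  ultimately show ?thesis using assms by (simp add: lift_walk_def of_nat_diff)
qed

text \<open>The zero total of \<open>c\<close> makes this sum a multiple of \<open>n\<close>, and
  the quotient reveals the base value \<open>c ! 0\<close>, which the differences defining
  \<open>lift_walk\<close> forget.\<close>

lemma sum_lift_walk:
  assumes "c \<in> cyclic_walks n" "0 < n"
  shows "(\<Sum>i\<in>{1..<n}. lift_walk c i) = int n * (int n - 1 - c ! 0)"
proof -
  have "(\<Sum>i<n. lift_walk c i) = (\<Sum>i<n. c ! i) - int n * c ! 0 + 2 * (\<Sum>i<n. int i)"
    by (simp add: lift_walk_def sum.distrib sum_subtractf sum_distrib_left)
  also have "(\<Sum>i<n. c ! i) = 0"
    using assms sum_eq_sum_sum_list_nth[of c n] by (simp add: cyclic_walks_def)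
  also have "2 * (\<Sum>i<n. int i) = int n * (int n - 1)"
    by (induction n) (auto simp: algebra_simps)
  also have "(\<Sum>i<n. lift_walk c i) = (\<Sum>i\<in>{1..<n}. lift_walk c i)"
    using assms(2) by (intro sum.mono_neutral_right) (auto simp: lift_walk_def not_le)
  finally show ?thesis by (simp add: algebra_simps)
qed

lemma sorted_list_of_strict_mono_image:
  fixes z :: "nat \<Rightarrow> nat"
  assumes "\<And>i j. i < j \<Longrightarrow> j < n \<Longrightarrow> 1 \<le> i \<Longrightarrow> z i < z j"
  shows "sorted_list_of_set (z ` {1..<n}) = map z [1..<n]"
proof -
  have "sorted_wrt (<) (map z [1..<n])"
    unfolding sorted_wrt_map by (rule sorted_wrt_mono_rel[OF _ sorted_wrt_upt]) (use assms in auto)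
  then show ?thesis
    using sorted_list_of_set.idem_if_sorted_distinct[of "map z [1..<n]"] by (simp add: strict_sorted_iff)
qed

text \<open>The set determines the increasing sequence of lifts, and its sum determines
  \<open>c ! 0\<close>. Divisibility of the sum by \<open>n\<close> is what makes that base value an
  integer.\<close>

lemma bij_betw_cyclic_walks_subsets:
  assumes "0 < n"
  shows "bij_betw (\<lambda>c. (nat \<circ> lift_walk c) ` {1..<n}) (cyclic_walks n)
    {Y. Y \<subseteq> {1..2 * n - 1} \<and> card Y = n - 1 \<and> n dvd \<Sum>Y}"
  unfolding bij_betw_def
proof
  have mono: "(nat \<circ> lift_walk c) i < (nat \<circ> lift_walk c) j"
    if "c \<in> cyclic_walks n" "i < j" "j < n" "1 \<le> i" for c i j
    using lift_walk_mono[OF that(1-3)] lift_walk_bounds[OF that(1), of i] that by auto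
  show "inj_on (\<lambda>c. (nat \<circ> lift_walk c) ` {1..<n}) (cyclic_walks n)"
  proof
    fix c d assume c: "c \<in> cyclic_walks n" and d: "d \<in> cyclic_walks n"
      and eq: "(nat \<circ> lift_walk c) ` {1..<n} = (nat \<circ> lift_walk d) ` {1..<n}"
    have "map (nat \<circ> lift_walk c) [1..<n] = map (nat \<circ> lift_walk d) [1..<n]"
      using sorted_list_of_strict_mono_image[of n "nat \<circ> lift_walk c"]
        sorted_list_of_strict_mono_image[of n "nat \<circ> lift_walk d"] mono[OF c] mono[OF d] eq by metis
    then have nat_eq: "nat (lift_walk c i) = nat (lift_walk d i)" if "1 \<le> i" "i < n" for i
      using that by (simp add: map_eq_conv)
    have "lift_walk c i = lift_walk d i" if "1 \<le> i" "i < n" for i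
      using nat_eq[OF that] lift_walk_bounds[OF c that] lift_walk_bounds[OF d that] that by (simp add: eq_nat_nat_iff)
    moreover from this have "int n * (int n - 1 - c ! 0) = int n * (int n - 1 - d ! 0)"
      using sum_lift_walk[OF c assms] sum_lift_walk[OF d assms] by simp
    then have "c ! 0 = d ! 0" using assms by simp
    ultimately have "c ! i = d ! i" if "i < n" for i
      using that by (cases "i = 0") (auto simp: lift_walk_def)
    then show "c = d" using c d by (intro nth_equalityI) (auto simp: cyclic_walks_def)
  qed
  show "(\<lambda>c. (nat \<circ> lift_walk c) ` {1..<n}) ` cyclic_walks n =
      {Y. Y \<subseteq> {1..2 * n - 1} \<and> card Y = n - 1 \<and> n dvd \<Sum>Y}" (is "?h ` _ = ?Y")
  proof
    show "?h ` cyclic_walks n \<subseteq> ?Y"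
    proof clarify
      fix c assume c: "c \<in> cyclic_walks n"
      have inj: "inj_on (nat \<circ> lift_walk c) {1..<n}"
        by (rule linorder_inj_onI) (use mono[OF c] in \<open>force+\<close>)
      have "\<Sum>(?h c) = (\<Sum>i\<in>{1..<n}. nat (lift_walk c i))"
        using sum.reindex[OF inj, of "\<lambda>x. x"] by simp
      then have "int (\<Sum>(?h c)) = (\<Sum>i\<in>{1..<n}. int (nat (lift_walk c i)))"
        by (simp only: of_nat_sum)
      also have "\<dots> = (\<Sum>i\<in>{1..<n}. lift_walk c i)"
      proof (intro sum.cong refl)
        fix i assume "i \<in> {1..<n}"
        then show "int (nat (lift_walk c i)) = lift_walk c i" using lift_walk_bounds[OF c, of i] by simp
      qed
      finally have "int n dvd int (\<Sum>(?h c))" using sum_lift_walk[OF c assms] by simp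
      moreover have "nat (lift_walk c i) \<in> {1..2 * n - 1}" if "i \<in> {1..<n}" for i
        using lift_walk_bounds[OF c, of i] that by auto
      then have "?h c \<subseteq> {1..2 * n - 1}" by auto
      ultimately show "?h c \<subseteq> {1..2 * n - 1} \<and> card (?h c) = n - 1 \<and> n dvd \<Sum>(?h c)"
        using card_image[OF inj] by (simp only: int_dvd_int_iff) simp
    qed
    show "?Y \<subseteq> ?h ` cyclic_walks n"
    proof clarify
      fix Y assume Y: "Y \<subseteq> {1..2 * n - 1}" and card: "card Y = n - 1" and "n dvd \<Sum>Y"
      then obtain q where q: "\<Sum>Y = n * q" by blast
      have fin: "finite Y" using Y finite_subset by blast
      \<comment> \<open>The leading \<open>0\<close> is the lift at index \<open>0\<close>. The
        constant \<open>n - 1 - q\<close> in \<open>c\<close> is the base value that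
        \<open>sum_lift_walk\<close> forces when \<open>\<Sum>Y = n * q\<close>.\<close>
      define ys where "ys = 0 # sorted_list_of_set Y"
      define c where "c = map (\<lambda>i. int (ys ! i) - 2 * int i + (int n - 1 - int q)) [0..<n]"
      have len: "length ys = n" using card assms by (simp add: ys_def)
      have set_ys: "set ys = insert 0 Y" using fin by (simp add: ys_def)
      have "sorted_wrt (<) ys"
        using Y fin by (auto simp: ys_def)
      then have ys_mono: "ys ! i < ys ! j" if "i < j" "j < n" for i j
        using that len sorted_wrt_nth_less by blast
      have ys_le: "ys ! i \<le> 2 * n - 1" if "i < n" for i
        using that len set_ys Y nth_mem[of i ys] by auto
      have nth: "c ! i = int (ys ! i) - 2 * int i + (int n - 1 - int q)" if "i < n" for i
        using that by (simp add: c_def)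
      have "(\<Sum>i<n. ys ! i) = sum_list ys" using len by (simp add: sum_list_sum_nth atLeast0LessThan)
      also have "\<dots> = \<Sum>Y" using fin sum_list_distinct_conv_sum_set[of "sorted_list_of_set Y" "\<lambda>x. x"] by (simp add: ys_def)
      finally have sum_ys: "(\<Sum>i<n. int (ys ! i)) = int n * int q" using q by (metis of_nat_sum of_nat_mult)
      have "sum_list c = (\<Sum>i<n. c ! i)" by (intro sum_eq_sum_sum_list_nth) (simp add: c_def)
      also have "\<dots> = (\<Sum>i<n. int (ys ! i)) - 2 * (\<Sum>i<n. int i) + int n * (int n - 1 - int q)"
        by (simp add: nth sum.distrib sum_subtractf sum_distrib_left)
      also have "2 * (\<Sum>i<n. int i) = int n * (int n - 1)"
        by (induction n) (auto simp: algebra_simps)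
      finally have sum_c: "sum_list c = 0" using sum_ys by (simp add: algebra_simps)
      have "c ! i - 1 \<le> c ! (Suc i mod n)" if "i < n" for i
      proof (cases "Suc i = n")
        case True
        then show ?thesis using that nth[of i] nth[of 0] ys_le[of i] by (auto simp: ys_def)
      next
        case False
        then show ?thesis using that nth[of i] nth[of "Suc i"] ys_mono[of i "Suc i"] by simp
      qed
      then have "c \<in> cyclic_walks n" using sum_c by (auto simp: cyclic_walks_def c_def)
      moreover have "lift_walk c i = int (ys ! i)" if "i < n" for i
        using that assms nth[of i] nth[of 0] by (simp add: lift_walk_def ys_def)
      then have "?h c = (\<lambda>i. ys ! i) ` {1..<n}" by (intro image_cong) auto
      moreover have "(\<lambda>i. ys ! i) ` {1..<n} = Y"
      proof -
        have "(\<lambda>i. ys ! i) ` {1..<n} = (\<lambda>i. ys ! Suc i) ` {0..<n - 1}"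
          using image_Suc_atLeastLessThan[of 0 "n - 1"] assms by (metis One_nat_def Suc_pred image_image)
        also have "\<dots> = set (sorted_list_of_set Y)"
          using len by (auto simp: ys_def set_conv_nth)
        finally show ?thesis using fin by simp
      qed
      ultimately show "Y \<in> ?h ` cyclic_walks n" by blast
    qed
  qed
qed

lemma card_cyclic_walks: "0 < n \<Longrightarrow> card (cyclic_walks n) = N n"
  using bij_betw_same_card[OF bij_betw_cyclic_walks_subsets] by (simp add: N_eq_card_complements)

theorem score_sequence_recurrence: "n * S n = (\<Sum>k\<in>{1..n}. N k * S (n - k))"
  using excursion_recurrence[of n] by (simp add: S_eq_card_excursions card_cyclic_walks)

section \<open>Root of unity filter\<close>

text \<open>Elementary symmetric functions as coefficients. With \<open>a i = \<eta> ^ i\<close> the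
  coefficient becomes the sum of \<open>\<eta> ^ \<Sum>X\<close> over the \<open>k\<close>-subsets
  \<open>X\<close>.\<close>

lemma coeff_prod_one_plus_monom:
  fixes a :: "'b \<Rightarrow> 'a :: comm_ring_1"
  assumes "finite A"
  shows "coeff (\<Prod>i\<in>A. monom (a i) 1 + 1) k = (\<Sum>X | X \<subseteq> A \<and> card X = k. \<Prod>i\<in>X. a i)"
proof -
  have monom: "(\<Prod>i\<in>X. monom (a i) (Suc 0)) = monom (\<Prod>i\<in>X. a i) (card X)" if "finite X" for X
    using that by induction (auto simp: mult_monom one_poly_def)
  have "(\<Prod>i\<in>A. monom (a i) 1 + 1) = (\<Sum>X\<in>Pow A. monom (\<Prod>i\<in>X. a i) (card X))"
    using assms by (auto simp: prod_add monom finite_subset intro!: sum.cong)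
  then have "coeff (\<Prod>i\<in>A. monom (a i) 1 + 1) k =
      (\<Sum>X\<in>Pow A. if card X = k then \<Prod>i\<in>X. a i else 0)"
    by (simp add: coeff_sum coeff_monom)
  also have "\<dots> = (\<Sum>X\<in>{X \<in> Pow A. card X = k}. \<Prod>i\<in>X. a i)"
    using assms by (intro sum.inter_filter[symmetric]) auto
  finally show ?thesis by (simp add: Pow_def)
qed

text \<open>Substituting \<open>\<eta> z\<close> for \<open>z\<close> permutes the factors, so only the exponents \<open>0\<close> and \<open>d\<close> survive.\<close>

lemma prod_primitive_root:
  fixes \<eta> :: complex
  assumes "0 < d" "\<eta> ^ d = 1" "\<And>k. 0 < k \<Longrightarrow> k < d \<Longrightarrow> \<eta> ^ k \<noteq> 1" "norm \<eta> = 1"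
  obtains c where "norm c = 1" "(\<Prod>i<d. monom (\<eta> ^ i) 1 + 1) = monom c d + 1"
proof -
  define q where "q = (\<Prod>i<d. monom (\<eta> ^ i) 1 + 1)"
  have coeff_q: "coeff q k = (\<Sum>X | X \<subseteq> {..<d} \<and> card X = k. \<Prod>i\<in>X. \<eta> ^ i)" for k
    unfolding q_def by (rule coeff_prod_one_plus_monom) simp
  have "pcompose q [:0, \<eta>:] = (\<Prod>i<d. monom (\<eta> ^ Suc i) 1 + 1)"
    unfolding q_def pcompose_prod
    by (intro prod.cong) (auto simp: pcompose_add pcompose_1 monom_Suc monom_0 pcompose_pCons)
  also have "\<dots> = q"
  proof -
    obtain d' where d': "d = Suc d'" using assms(1) by (cases d) auto
    show ?thesis
      unfolding q_def d' using assms(2)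
      by (subst prod.lessThan_Suc, subst prod.lessThan_Suc_shift) (simp add: d' mult.commute)
  qed
  finally have "pcompose q [:0, \<eta>:] = q" .
  then have "\<eta> ^ k * coeff q k = coeff q k" for k
    using coeff_pcompose_linear[of q \<eta> k] by simp
  then have mid: "coeff q k = 0" if "0 < k" "k < d" for k
    using assms(3)[OF that] by (metis mult_cancel_right1)
  have high: "coeff q k = 0" if "d < k" for k
  proof -
    have "card X \<noteq> k" if "X \<subseteq> {..<d}" for X
      using card_mono[OF _ that] \<open>d < k\<close> by auto
    then have "{X. X \<subseteq> {..<d} \<and> card X = k} = {}" by auto
    then show ?thesis by (simp only: coeff_q sum.empty)
  qed
  have "{X. X \<subseteq> {..<d} \<and> card X = 0} = {{}}"
    by (auto dest: finite_subset)
  then have low: "coeff q 0 = 1" by (simp add: coeff_q)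
  have "{X. X \<subseteq> {..<d} \<and> card X = d} = {{..<d}}"
    using card_subset_eq[of "{..<d}"] by auto
  then have "coeff q d = (\<Prod>i<d. \<eta> ^ i)" by (simp add: coeff_q)
  then have "norm (coeff q d) = 1"
    by (simp add: norm_power assms(4) flip: prod_norm)
  moreover have "q = monom (coeff q d) d + 1"
    using mid high low assms(1) by (intro poly_eqI) (auto simp: linorder_neq_iff)
  ultimately show thesis using that by (simp add: q_def)
qed

text \<open>By the triangle inequality the binomial coefficients of row \<open>m\<close> bound every
  single coefficient by their total.\<close>

lemma norm_coeff_binomial_power_le:
  fixes c :: complex
  assumes "norm c = 1"
  shows "norm (coeff ((monom c d + 1) ^ m) k) \<le> 2 ^ m"
proof -
  have "(monom c d + 1) ^ m = (\<Sum>j\<le>m. monom (of_nat (m choose j) * c ^ j) (d * j))"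
    by (simp add: binomial_ring monom_power of_nat_monom mult_monom)
  then have "norm (coeff ((monom c d + 1) ^ m) k) \<le>
      (\<Sum>j\<le>m. norm (coeff (monom (of_nat (m choose j) * c ^ j) (d * j)) k))"
    by (simp add: coeff_sum norm_sum)
  also have "\<dots> \<le> (\<Sum>j\<le>m. real (m choose j))"
    by (intro sum_mono) (simp add: norm_mult norm_power assms coeff_monom)
  also have "\<dots> = 2 ^ m"
    by (simp add: choose_row_sum flip: of_nat_sum)
  finally show ?thesis .
qed

text \<open>If \<open>\<eta>\<close> has order \<open>d\<close> and \<open>n = d * e\<close>, the
  \<open>2 * n\<close> factors fall into \<open>2 * e\<close> full periods, each with product
  \<open>monom c d + 1\<close>. Since \<open>d \<ge> 2\<close>, there are at most \<open>n\<close>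
  periods.\<close>

lemma norm_sum_root_subsets_le:
  fixes \<eta> :: complex
  assumes "0 < n" "\<eta> ^ n = 1" "\<eta> \<noteq> 1"
  shows "norm (\<Sum>X | X \<subseteq> {..<2 * n} \<and> card X = n. \<eta> ^ \<Sum>X) \<le> 2 ^ n"
proof -
  define d where "d = (LEAST d. 0 < d \<and> \<eta> ^ d = 1)"
  have d: "0 < d" "\<eta> ^ d = 1"
    unfolding d_def using LeastI[of "\<lambda>d. 0 < d \<and> \<eta> ^ d = 1" n] assms by auto
  have d_min: "\<eta> ^ k \<noteq> 1" if "0 < k" "k < d" for k
    using that not_less_Least[of k "\<lambda>d. 0 < d \<and> \<eta> ^ d = 1"] by (auto simp: d_def)
  have "norm \<eta> ^ n = 1" using assms(2) by (metis norm_one norm_power)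
  then have norm: "norm \<eta> = 1" using assms(1) power_eq_imp_eq_base[of "norm \<eta>" n 1] by simp
  have period: "\<eta> ^ (m * d + i) = \<eta> ^ i" for m i
    using d(2) by (simp add: power_add power_mult mult.commute[of m])
  have "\<eta> ^ (n mod d) = 1"
    using period[of "n div d" "n mod d"] assms(2) by simp
  then have "d dvd n" using d_min[of "n mod d"] d(1) by (auto simp: dvd_eq_mod_eq_0)
  then obtain e where e: "n = d * e" by blast
  have "d \<noteq> 1" using d(2) assms(3) by auto
  then have "2 \<le> d" using d(1) by simp
  then have e_le: "2 * e \<le> n" by (simp add: e)
  obtain c where c: "norm c = 1" "(\<Prod>i<d. monom (\<eta> ^ i) 1 + 1) = monom c d + 1"
    using prod_primitive_root[OF d d_min norm] by blast
  have block: "(\<Prod>i = m * d..<m * d + d. monom (\<eta> ^ i) 1 + 1) = monom c d + 1" for m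
  proof -
    have "(\<Prod>i = m * d..<m * d + d. monom (\<eta> ^ i) 1 + 1) = (\<Prod>i<d. monom (\<eta> ^ (m * d + i)) 1 + 1)"
      by (rule prod.reindex_bij_witness[of _ "\<lambda>i. m * d + i" "\<lambda>i. i - m * d"]) auto
    then show ?thesis by (simp only: period c(2))
  qed
  have "(\<Prod>i<2 * n. monom (\<eta> ^ i) 1 + 1) = (\<Prod>m<2 * e. \<Prod>i = m * d..<m * d + d. monom (\<eta> ^ i) 1 + 1)"
    by (simp add: prod.nat_group e mult_ac)
  also have "\<dots> = (monom c d + 1) ^ (2 * e)"
    by (simp only: block prod_constant card_lessThan)
  finally have "coeff (\<Prod>i<2 * n. monom (\<eta> ^ i) 1 + 1) n = coeff ((monom c d + 1) ^ (2 * e)) n"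
    by simp
  moreover have "coeff (\<Prod>i<2 * n. monom (\<eta> ^ i) 1 + 1) n = (\<Sum>X | X \<subseteq> {..<2 * n} \<and> card X = n. \<eta> ^ \<Sum>X)"
    by (subst coeff_prod_one_plus_monom) (simp_all add: power_sum)
  ultimately have "norm (\<Sum>X | X \<subseteq> {..<2 * n} \<and> card X = n. \<eta> ^ \<Sum>X) \<le> 2 ^ (2 * e)"
    using norm_coeff_binomial_power_le[OF c(1)] by metis
  also have "\<dots> \<le> 2 ^ n" using e_le by simp
  finally show ?thesis .
qed

text \<open>Swapping \<open>j\<close> and \<open>s\<close> in the exponent turns the sum into a
  geometric series in \<open>z\<close>.\<close>

lemma sum_powers_root_of_unity:
  assumes "0 < n"
  shows "(\<Sum>j<n. exp (2 * of_real pi * \<i> * of_nat j / of_nat n) ^ s) =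
    (if n dvd s then of_nat n else (0 :: complex))"
proof -
  define z :: complex where "z = exp (2 * of_real pi * \<i> * of_nat s / of_nat n)"
  have "exp (2 * of_real pi * \<i> * of_nat j / of_nat n) ^ s = z ^ j" for j
    by (simp add: z_def mult_ac flip: exp_of_nat_mult)
  then have eq: "(\<Sum>j<n. exp (2 * of_real pi * \<i> * of_nat j / of_nat n) ^ s) = (\<Sum>j<n. z ^ j)" by simp
  have "z ^ n = 1" using complex_root_unity[of n s] assms by (simp add: z_def)
  moreover have "z = 1 \<longleftrightarrow> n dvd s"
    using complex_root_unity_eq_1[of n s] assms by (simp add: z_def)
  ultimately show ?thesis unfolding eq by (auto simp: geometric_sum)
qed

section \<open>Equidistribution of subset sums modulo n\<close>

text \<open>The filter writes \<open>n * card ?D\<close> as a sum over the \<open>n\<close>-th roots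
  of unity. The root \<open>1\<close> contributes all \<open>n\<close>-subsets, and each of the
  other \<open>n - 1\<close> roots at most \<open>2 ^ n\<close>.\<close>

lemma equidistribution_bound:
  assumes "0 < n"
  shows "\<bar>real n * real (card {X. X \<subseteq> {..<2 * n} \<and> card X = n \<and> n dvd \<Sum>X}) - real (2 * n choose n)\<bar>
    \<le> real n * 2 ^ n"
proof -
  let ?X = "{X. X \<subseteq> {..<2 * n} \<and> card X = n}"
  let ?D = "{X. X \<subseteq> {..<2 * n} \<and> card X = n \<and> n dvd \<Sum>X}"
  define w :: "nat \<Rightarrow> complex" where "w j = exp (2 * of_real pi * \<i> * of_nat j / of_nat n)" for j
  define T where "T j = (\<Sum>X\<in>?X. w j ^ \<Sum>X)" for j
  have fin: "finite ?X" by (rule finite_subset[of _ "Pow {..<2 * n}"]) auto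
  have "(\<Sum>j<n. T j) = (\<Sum>X\<in>?X. \<Sum>j<n. w j ^ \<Sum>X)"
    unfolding T_def by (rule sum.swap)
  also have "\<dots> = (\<Sum>X\<in>?X. if n dvd \<Sum>X then of_nat n else 0)"
    by (simp only: w_def sum_powers_root_of_unity[OF assms])
  also have "\<dots> = (\<Sum>X\<in>{X \<in> ?X. n dvd \<Sum>X}. of_nat n)"
    using fin by (rule sum.inter_filter[symmetric])
  also have "{X \<in> ?X. n dvd \<Sum>X} = ?D" by auto
  finally have total: "(\<Sum>j<n. T j) = of_nat n * of_nat (card ?D)" by (simp add: mult.commute)
  have "card ?X = 2 * n choose n" using n_subsets[of "{..<2 * n}" n] by simp
  then have T0: "T 0 = of_nat (2 * n choose n)" by (simp add: T_def w_def)
  have T_le: "norm (T j) \<le> 2 ^ n" if "j \<in> {1..<n}" for j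
  proof -
    have "\<not> n dvd j" using that by (auto dest: dvd_imp_le)
    then have "w j \<noteq> 1" using complex_root_unity_eq_1[of n j] assms by (simp add: w_def)
    moreover have "w j ^ n = 1" using complex_root_unity[of n j] assms by (simp add: w_def)
    ultimately show ?thesis unfolding T_def using norm_sum_root_subsets_le[OF assms] by blast
  qed
  have "(\<Sum>j<n. T j) = T 0 + (\<Sum>j\<in>{1..<n}. T j)"
    using assms by (simp add: sum.atLeast_Suc_lessThan flip: atLeast0LessThan)
  then have "norm (of_nat n * of_nat (card ?D) - of_nat (2 * n choose n) :: complex) = norm (\<Sum>j\<in>{1..<n}. T j)"
    using total T0 by simp
  also have "\<dots> \<le> (\<Sum>j\<in>{1..<n}. 2 ^ n)"
    using T_le by (rule sum_norm_le)
  also have "\<dots> \<le> real n * 2 ^ n" by (simp add: mult_right_mono)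
  finally have "norm (complex_of_real (real n * real (card ?D) - real (2 * n choose n))) \<le> real n * 2 ^ n"
    by simp
  then show ?thesis by (simp only: norm_of_real)
qed

text \<open>Including \<open>0\<close> in the ground set completes the periods for the filter. The
  element \<open>0\<close> does not change sums, so the subsets avoiding it are counted by
  \<open>N n\<close> directly, and those containing it by \<open>N n\<close> through
  complements.\<close>

lemma card_subsets_dvd_sum:
  assumes "0 < n"
  shows "card {X. X \<subseteq> {..<2 * n} \<and> card X = n \<and> n dvd \<Sum>X} = 2 * N n"
proof -
  let ?A = "{X. X \<subseteq> {1..2 * n - 1} \<and> card X = n \<and> n dvd \<Sum>X}"
  let ?B = "{Y. Y \<subseteq> {1..2 * n - 1} \<and> card Y = n - 1 \<and> n dvd \<Sum>Y}"
  have range: "{..<2 * n} = insert 0 {1..2 * n - 1}" using assms by auto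
  have ins: "card (insert 0 Y) = Suc (card Y)" "\<Sum>(insert 0 Y) = \<Sum>Y" if "Y \<subseteq> {1..2 * n - 1}" for Y
  proof -
    have "finite Y" "0 \<notin> Y" using that finite_subset by auto
    then show "card (insert 0 Y) = Suc (card Y)" "\<Sum>(insert 0 Y) = \<Sum>Y" by auto
  qed
  have "{X. X \<subseteq> {..<2 * n} \<and> card X = n \<and> n dvd \<Sum>X} = ?A \<union> insert 0 ` ?B"
  proof (intro Set.equalityI subsetI)
    fix X assume X: "X \<in> {X. X \<subseteq> {..<2 * n} \<and> card X = n \<and> n dvd \<Sum>X}"
    show "X \<in> ?A \<union> insert 0 ` ?B"
    proof (cases "0 \<in> X")
      case True
      define Y where "Y = X - {0}"
      have "X = insert 0 Y" "Y \<subseteq> {1..2 * n - 1}" using True X range by (auto simp: Y_def)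
      then show ?thesis using X ins[of Y] by auto
    next
      case False
      then have "X \<subseteq> {1..2 * n - 1}" using X range by auto
      with X show ?thesis by auto
    qed
  next
    fix X assume "X \<in> ?A \<union> insert 0 ` ?B"
    then show "X \<in> {X. X \<subseteq> {..<2 * n} \<and> card X = n \<and> n dvd \<Sum>X}"
      using ins assms range by auto
  qed
  moreover have "finite ?A" "finite ?B" "?A \<inter> insert 0 ` ?B = {}"
    by (auto intro: finite_subset[of _ "Pow {1..2 * n - 1}"])
  moreover have "inj_on (insert 0) ?B"
    by (rule inj_on_inverseI[where g = "\<lambda>X. X - {0}"]) auto
  ultimately show ?thesis
    using N_eq_card_complements[OF assms] by (simp add: card_Un_disjoint card_image N_def)
qed

theorem N_approx:
  assumes "0 < n"
  shows "\<bar>2 * (real n * real (N n)) - real (2 * n choose n)\<bar> \<le> real n * 2 ^ n"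
proof -
  have "real n * real (2 * N n) = 2 * (real n * real (N n))" by simp
  then show ?thesis using equidistribution_bound[OF assms] by (simp only: card_subsets_dvd_sum[OF assms])
qed

section \<open>Asymptotics of the recurrence\<close>

lemma summable_powser_unit:
  fixes c :: "nat \<Rightarrow> real"
  assumes "\<And>n. \<bar>c n\<bar> \<le> 1" "\<bar>x\<bar> < 1"
  shows "summable (\<lambda>n. \<bar>c n * x ^ n\<bar>)"
proof (rule summable_comparison_test')
  show "summable (\<lambda>n. \<bar>x\<bar> ^ n)" using assms(2) by (simp add: summable_geometric)
  show "norm \<bar>c n * x ^ n\<bar> \<le> \<bar>x\<bar> ^ n" if "0 \<le> n" for n
    using mult_right_mono[OF assms(1)[of n], of "\<bar>x\<bar> ^ n"] by (simp add: abs_mult power_abs)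
qed

text \<open>Abel's limit theorem for nonnegative summable coefficients, by dominated convergence
  with majorant \<open>c\<close>.\<close>

lemma powser_tendsto_at_left_1:
  fixes c :: "nat \<Rightarrow> real"
  assumes "\<And>n. 0 \<le> c n" "summable c"
  shows "((\<lambda>x. \<Sum>n. c n * x ^ n) \<longlongrightarrow> (\<Sum>n. c n)) (at_left 1)"
proof -
  have "((\<lambda>x. c n * x ^ n) \<longlongrightarrow> c n * 1 ^ n) (at_left 1)" for n
    by (intro tendsto_intros)
  moreover have "eventually (\<lambda>x. x \<in> {0<..<1}) (at_left (1 :: real))"
    by (rule eventually_at_left_real) simp
  then have "eventually (\<lambda>x. \<forall>n. norm (c n * x ^ n) \<le> c n) (at_left 1)"
  proof eventually_elim
    case (elim x)
    then show ?case using assms(1) by (auto simp: abs_mult power_abs intro!: mult_left_le power_le_one)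
  qed
  then have "eventually (\<lambda>(n, x). norm (c n * x ^ n) \<le> c n) (at_top \<times>\<^sub>F at_left 1)"
    unfolding eventually_prod_filter by (intro exI[of _ "\<lambda>_. True"] exI conjI) auto
  ultimately show ?thesis
    using tannerys_theorem[of "\<lambda>n x. c n * x ^ n" "\<lambda>n. c n * 1 ^ n" "at_left 1" c] assms(2) by simp
qed

text \<open>The recurrence says that the generating function \<open>f\<close> of \<open>s\<close> satisfies \<open>f' = A' f\<close>.\<close>

lemma exp_formula:
  fixes b s :: "nat \<Rightarrow> real"
  assumes s0: "s 0 = 1" and rec: "\<And>n. 0 < n \<Longrightarrow> real n * s n = (\<Sum>j<n. b (n - j) * s j)"
    and b: "\<And>n. \<bar>b n\<bar> \<le> 1" and s: "\<And>n. \<bar>s n\<bar> \<le> 1" and x: "\<bar>x\<bar> < 1"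
  shows "(\<Sum>n. s n * x ^ n) = exp (\<Sum>k. b k / real k * x ^ k)"
proof -
  \<comment> \<open>Division by zero yields \<open>0\<close>, so this agrees with
    \<open>b k / real k\<close> at \<open>0\<close> too; the constant term of the exponent vanishes
    whatever \<open>b 0\<close> is.\<close>
  define a where "a k = (if k = 0 then 0 else b k / real k)" for k
  have a: "\<bar>a k\<bar> \<le> 1" for k
  proof (cases "k = 0")
    case False
    then have "\<bar>b k\<bar> \<le> real k" using b[of k] by linarith
    then show ?thesis using False by (simp add: a_def)
  qed (simp add: a_def)
  define f where "f x = (\<Sum>n. s n * x ^ n)" for x
  define A where "A x = (\<Sum>k. a k * x ^ k)" for x
  have diffs_a: "diffs a k = b (Suc k)" for k by (simp add: diffs_def a_def)
  have df: "(f has_field_derivative (\<Sum>n. diffs s n * x ^ n)) (at x)" if "\<bar>x\<bar> < 1" for x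
    unfolding f_def
    by (rule termdiffs_strong'[where K = 1])
      (use summable_powser_unit[OF s] that in \<open>auto intro: summable_rabs_cancel\<close>)
  have dA: "(A has_field_derivative (\<Sum>n. diffs a n * x ^ n)) (at x)" if "\<bar>x\<bar> < 1" for x
    unfolding A_def
    by (rule termdiffs_strong'[where K = 1])
      (use summable_powser_unit[OF a] that in \<open>auto intro: summable_rabs_cancel\<close>)
  \<comment> \<open>The coefficients of the Cauchy product of \<open>f\<close> and \<open>A'\<close>
    are the right-hand sides of the recurrence.\<close>
  have ode: "(\<Sum>n. diffs s n * x ^ n) = f x * (\<Sum>n. diffs a n * x ^ n)" if x: "\<bar>x\<bar> < 1" for x
  proof -
    have "(\<lambda>n. \<Sum>i\<le>n. (s i * x ^ i) * (diffs a (n - i) * x ^ (n - i))) sums (f x * (\<Sum>n. diffs a n * x ^ n))"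
      unfolding f_def
      by (rule Cauchy_product_sums)
        (use summable_powser_unit[OF s x] summable_powser_unit[of "diffs a", OF _ x] b in \<open>simp_all add: diffs_a\<close>)
    moreover have "(\<Sum>i\<le>n. (s i * x ^ i) * (diffs a (n - i) * x ^ (n - i))) = diffs s n * x ^ n" for n
    proof -
      have "(\<Sum>i\<le>n. (s i * x ^ i) * (diffs a (n - i) * x ^ (n - i))) = (\<Sum>i\<le>n. b (Suc n - i) * s i * x ^ n)"
        by (intro sum.cong) (auto simp: diffs_a Suc_diff_le power_add[symmetric] mult_ac)
      also have "\<dots> = diffs s n * x ^ n"
        using rec[of "Suc n"] by (simp add: diffs_def sum_distrib_right lessThan_Suc_atMost)
      finally show ?thesis .
    qed
    ultimately show ?thesis by (simp add: sums_iff)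
  qed
  have "\<exists>c. \<forall>x\<in>{-1<..<1}. f x * exp (- A x) = c"
  proof (rule has_field_derivative_zero_constant)
    fix x :: real assume "x \<in> {-1<..<1}"
    then have "\<bar>x\<bar> < 1" by auto
    from df[OF this] dA[OF this] ode[OF this]
    show "((\<lambda>x. f x * exp (- A x)) has_field_derivative 0) (at x within {-1<..<1})"
      by (auto intro!: derivative_eq_intros intro: has_field_derivative_at_within simp: algebra_simps)
  qed auto
  then obtain c where c: "\<And>x. x \<in> {-1<..<1} \<Longrightarrow> f x * exp (- A x) = c" by blast
  have "f 0 = 1" "A 0 = 0" by (simp_all add: f_def A_def s0 a_def)
  then have "c = 1" using c[of 0] by simp
  then have "f x = exp (A x)" using c[of x] x by (simp add: exp_minus field_simps abs_less_iff)
  moreover have "A x = (\<Sum>k. b k / real k * x ^ k)"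
    unfolding A_def by (intro suminf_cong) (auto simp: a_def)
  ultimately show ?thesis by (simp add: f_def)
qed

section \<open>Transfer of asymptotics from the weights to the solution\<close>

text \<open>Halving the argument costs at most the factor \<open>2 powr (3/2)\<close>, rounded up to
  \<open>4\<close>.\<close>

lemma powr_le_of_half_le:
  assumes "0 < n" "n \<le> 2 * m"
  shows "real m powr (-3/2) \<le> 4 * real n powr (-3/2)"
proof -
  have "real m powr (-3/2) \<le> (real n / 2) powr (-3/2)"
    using assms by (intro powr_mono2') auto
  also have "\<dots> = 2 powr (3/2) * real n powr (-3/2)"
    by (simp add: powr_divide powr_minus field_simps)
  also have "2 powr (3/2) \<le> 2 powr (2::real)" by (intro powr_mono) auto
  then have "2 powr (3/2) * real n powr (-3/2) \<le> 4 * real n powr (-3/2)"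
    by (intro mult_right_mono) auto
  finally show ?thesis .
qed

lemma tendsto_const_over_n: "(\<lambda>n. C / real n) \<longlonglongrightarrow> 0"
  by real_asymp

text \<open>The sum is cut at \<open>j = n / 2\<close>. Below the cut \<open>b (n - j)\<close> is
  close to \<open>\<kappa> * r n\<close> and dominated convergence applies; above it an a priori
  bound of order \<open>r n / n\<close> on \<open>s\<close> makes the contribution negligible
  against \<open>r n\<close>.\<close>

theorem log_convolution_asymptotics:
  fixes b s :: "nat \<Rightarrow> real"
  assumes s0: "s 0 = 1" and rec: "\<And>n. 0 < n \<Longrightarrow> real n * s n = (\<Sum>j<n. b (n - j) * s j)"
    and b_nonneg: "\<And>n. 0 \<le> b n" and b_le_1: "\<And>n. b n \<le> 1"
    and lim: "(\<lambda>n. b n / real n powr (-3/2)) \<longlonglongrightarrow> \<kappa>"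
  shows "summable (\<lambda>k. b k / real k)"
    and "(\<lambda>n. real n * s n / real n powr (-3/2)) \<longlonglongrightarrow> \<kappa> * exp (\<Sum>k. b k / real k)"
proof -
  define r where "r n = real n powr (-3/2)" for n
  have r_pos: "0 < r n" if "0 < n" for n using that by (simp add: r_def)
  have r_half: "r m \<le> 4 * r n" if "0 < n" "n \<le> 2 * m" for m n
    unfolding r_def using powr_le_of_half_le[OF that] .
  have s_bounds: "0 \<le> s n \<and> s n \<le> 1" for n
  proof (induction n rule: less_induct)
    case (less n)
    show ?case
    proof (cases "n = 0")
      case False
      have "0 \<le> (\<Sum>j<n. b (n - j) * s j)" using less b_nonneg by (intro sum_nonneg) auto
      moreover have "(\<Sum>j<n. b (n - j) * s j) \<le> (\<Sum>j<n. 1)"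
        using less b_nonneg b_le_1 by (intro sum_mono mult_le_one) auto
      ultimately have "0 \<le> real n * s n" "real n * s n \<le> real n * 1" using rec[of n] False by auto
      then show ?thesis using False by (simp add: zero_le_mult_iff)
    qed (simp add: s0)
  qed
  then have s_nonneg: "0 \<le> s n" and s_le_1: "s n \<le> 1" for n by auto
  obtain B where B_pos: "0 < B" and B': "\<And>n. \<bar>b n / r n\<bar> \<le> B"
    using convergent_imp_Bseq[OF convergentI[OF lim]] by (auto simp: Bseq_def r_def)
  have B: "b n \<le> B * r n" if "0 < n" for n
    using B'[of n] r_pos[OF that] b_nonneg[of n] by (simp add: field_simps)
  have "summable (\<lambda>n. B * r n)"
    unfolding r_def by (intro summable_mult) (simp add: summable_real_powr_iff)
  then have b_summable: "summable b"
    by (rule summable_comparison_test'[where N = 1]) (use B b_nonneg in auto)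
  show a_summable: "summable (\<lambda>k. b k / real k)"
  proof (rule summable_comparison_test'[OF b_summable])
    fix n :: nat assume "1 \<le> n"
    then show "norm (b n / real n) \<le> b n"
      using b_nonneg[of n] mult_right_mono[of 1 "real n" "b n"] by (simp add: field_simps)
  qed
  define E where "E = exp (\<Sum>k. b k / real k)"
  have f_eq: "(\<Sum>n. s n * x ^ n) = exp (\<Sum>k. b k / real k * x ^ k)" if "\<bar>x\<bar> < 1" for x
    using exp_formula[OF s0 rec _ _ that] b_nonneg b_le_1 s_nonneg s_le_1 by simp
  have f_lim: "((\<lambda>x. \<Sum>n. s n * x ^ n) \<longlongrightarrow> E) (at_left 1)"
  proof -
    have "((\<lambda>x. exp (\<Sum>k. b k / real k * x ^ k)) \<longlongrightarrow> E) (at_left 1)"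
      unfolding E_def by (intro tendsto_exp powser_tendsto_at_left_1 a_summable) (simp add: b_nonneg)
    moreover have "eventually (\<lambda>x. x \<in> {0<..<1}) (at_left (1 :: real))"
      by (rule eventually_at_left_real) simp
    then have "eventually (\<lambda>x. exp (\<Sum>k. b k / real k * x ^ k) = (\<Sum>n. s n * x ^ n)) (at_left 1)"
      by eventually_elim (simp add: f_eq)
    ultimately show ?thesis by (rule Lim_transform_eventually)
  qed
  \<comment> \<open>For \<open>x < 1\<close> the partial sums lie below the full series, which tends
    to \<open>E\<close>; letting \<open>x\<close> tend to \<open>1\<close> bounds the partial sums
    of \<open>s\<close>.\<close>
  have s_summable: "summable s"
  proof (rule bounded_imp_summable)
    fix N
    have "((\<lambda>x. \<Sum>n\<le>N. s n * x ^ n) \<longlongrightarrow> (\<Sum>n\<le>N. s n * 1 ^ n)) (at_left 1)"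
      by (intro tendsto_intros)
    moreover have "eventually (\<lambda>x. x \<in> {0<..<1}) (at_left (1 :: real))"
      by (rule eventually_at_left_real) simp
    then have "eventually (\<lambda>x. (\<Sum>n\<le>N. s n * x ^ n) \<le> (\<Sum>n. s n * x ^ n)) (at_left 1)"
    proof eventually_elim
      case (elim x)
      then show ?case
        using summable_powser_unit[of s x] s_nonneg s_le_1
        by (intro sum_le_suminf) (auto intro: summable_rabs_cancel)
    qed
    ultimately show "(\<Sum>n\<le>N. s n) \<le> E"
      using tendsto_le[OF _ f_lim] by (simp add: trivial_limit_at_left_real)
  qed (rule s_nonneg)
  have sum_s: "(\<Sum>n. s n) = E"
    using tendsto_unique[OF _ powser_tendsto_at_left_1[OF s_nonneg s_summable] f_lim]
    by (simp add: trivial_limit_at_left_real)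
  define \<beta> where "\<beta> = (\<Sum>n. b n)"
  have \<beta>_nonneg: "0 \<le> \<beta>" unfolding \<beta>_def by (intro suminf_nonneg b_summable b_nonneg)
  have sum_b_le: "(\<Sum>j\<in>J. b (n - j)) \<le> \<beta>" if "J \<subseteq> {..<n}" for J n
  proof -
    have "finite J" using that finite_subset by blast
    have "(\<Sum>j\<in>J. b (n - j)) = (\<Sum>k\<in>(-) n ` J. b k)"
      using that by (subst sum.reindex) (auto simp: inj_on_def subset_iff)
    also have "\<dots> \<le> \<beta>"
      unfolding \<beta>_def using \<open>finite J\<close> b_nonneg by (intro sum_le_suminf b_summable) auto
    finally show ?thesis .
  qed
  have sum_s_le: "(\<Sum>j\<in>J. s j) \<le> E" if "finite J" for J
    unfolding sum_s[symmetric] using that s_nonneg by (intro sum_le_suminf s_summable) auto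
  have split: "real n * s n = (\<Sum>j | j < n \<and> 2 * j \<le> n. b (n - j) * s j) + (\<Sum>j | j < n \<and> n < 2 * j. b (n - j) * s j)"
    if "0 < n" for n
  proof -
    have "{..<n} = {j. j < n \<and> 2 * j \<le> n} \<union> {j. j < n \<and> n < 2 * j}" by auto
    then show ?thesis unfolding rec[OF that] by (simp add: sum.union_disjoint disjoint_iff)
  qed
  \<comment> \<open>For \<open>j > n / 2\<close> the assumed bound loses a factor \<open>4\<close>
    in \<open>r\<close> and \<open>2\<close> in the denominator, whence the \<open>8\<close>. It is
    assumed only for \<open>j < n\<close>, so that it can serve as induction hypothesis in
    \<open>s_le\<close>.\<close>
  have tail: "(\<Sum>j | j < n \<and> n < 2 * j. b (n - j) * s j) \<le> 8 * C * \<beta> * r n / real n"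
    if n: "0 < n" and C: "0 \<le> C" "\<And>j. 0 < j \<Longrightarrow> j < n \<Longrightarrow> s j \<le> C * r j / real j" for n C
  proof -
    have "s j \<le> 8 * C * r n / real n" if "j < n" "n < 2 * j" for j
    proof -
      have "s j \<le> C * r j / real j" using C(2)[of j] that by simp
      also have "\<dots> \<le> C * (4 * r n) / (real n / 2)"
        using that n r_half[of n j] C(1) r_pos[of n] r_pos[of j] by (intro frac_le mult_left_mono) auto
      finally show ?thesis by simp
    qed
    then have "(\<Sum>j | j < n \<and> n < 2 * j. b (n - j) * s j) \<le>
        (\<Sum>j | j < n \<and> n < 2 * j. b (n - j) * (8 * C * r n / real n))"
      using b_nonneg by (intro sum_mono mult_left_mono) auto
    also have "\<dots> = (\<Sum>j | j < n \<and> n < 2 * j. b (n - j)) * (8 * C * r n / real n)"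
      by (rule sum_distrib_right[symmetric])
    also have "\<dots> \<le> \<beta> * (8 * C * r n / real n)"
      using C(1) r_pos[OF n] by (intro mult_right_mono sum_b_le) auto
    finally show ?thesis by (simp add: mult_ac)
  qed
  \<comment> \<open>The first summand lets the lower half of the sum use at most
    \<open>C * r n / 2\<close>, and so does the upper half once \<open>n > 16 * \<beta>\<close>. The
    second summand covers \<open>n \<le> 16 * \<beta>\<close>, where \<open>s n \<le> 1\<close>
    suffices.\<close>
  define C where "C = 8 * B * E + (16 * \<beta> + 1) * (16 * \<beta> + 1) powr (3/2)"
  have E_pos: "0 < E" by (simp add: E_def)
  have C_pos: "0 < C" unfolding C_def using B_pos E_pos \<beta>_nonneg by (intro add_pos_nonneg) auto
  have s_le: "s n \<le> C * r n / real n" if "0 < n" for n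
    using that
  proof (induction n rule: less_induct)
    case (less n)
    show ?case
    proof (cases "real n \<le> 16 * \<beta>")
      case True
      have "real n * real n powr (3/2) \<le> (16 * \<beta> + 1) * (16 * \<beta> + 1) powr (3/2)"
        using True by (intro mult_mono powr_mono2) auto
      also have "\<dots> \<le> C" unfolding C_def using B_pos E_pos by simp
      finally have "real n \<le> C * r n"
        using less.prems by (simp add: r_def powr_minus field_simps)
      then have "1 \<le> C * r n / real n" using less.prems by simp
      with s_le_1[of n] show ?thesis by linarith
    next
      case False
      have "(\<Sum>j | j < n \<and> 2 * j \<le> n. b (n - j) * s j) \<le> (\<Sum>j | j < n \<and> 2 * j \<le> n. B * (4 * r n) * s j)"
      proof (intro sum_mono mult_right_mono s_nonneg)
        fix j assume "j \<in> {j. j < n \<and> 2 * j \<le> n}"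
        then have "0 < n - j" "n \<le> 2 * (n - j)" by auto
        then have "b (n - j) \<le> B * r (n - j)" "r (n - j) \<le> 4 * r n" using B r_half less.prems by auto
        then show "b (n - j) \<le> B * (4 * r n)"
          using B_pos by (meson less_imp_le mult_left_mono order_trans)
      qed
      also have "\<dots> = B * (4 * r n) * (\<Sum>j | j < n \<and> 2 * j \<le> n. s j)" by (simp add: sum_distrib_left)
      also have "\<dots> \<le> B * (4 * r n) * E"
        using B_pos r_pos[OF less.prems] by (intro mult_left_mono sum_s_le) auto
      finally have head: "(\<Sum>j | j < n \<and> 2 * j \<le> n. b (n - j) * s j) \<le> B * (4 * r n) * E" .
      have "(\<Sum>j | j < n \<and> n < 2 * j. b (n - j) * s j) \<le> 8 * C * \<beta> * r n / real n"
        using less.IH less.prems C_pos by (intro tail) auto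
      also have "8 * C * \<beta> * r n / real n = (C * r n) * (8 * \<beta> / real n)" by simp
      also have "\<dots> \<le> (C * r n) * (1 / 2)"
        using False less.prems C_pos r_pos[OF less.prems] by (intro mult_left_mono) (auto simp: field_simps)
      finally have "real n * s n \<le> B * (4 * r n) * E + C * r n / 2"
        using head split[OF less.prems] by simp
      also have "B * (4 * r n) * E = (8 * B * E) * r n / 2" by simp
      also have "(8 * B * E) * r n / 2 + C * r n / 2 \<le> C * r n / 2 + C * r n / 2"
      proof -
        have "8 * B * E \<le> C" unfolding C_def using \<beta>_nonneg by simp
        then have "(8 * B * E) * r n \<le> C * r n"
          using r_pos[OF less.prems] by (intro mult_right_mono) auto
        then show ?thesis by linarith
      qed
      finally show ?thesis using less.prems by (simp add: field_simps)
    qed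
  qed
  \<comment> \<open>The terms of the lower half divided by \<open>r n\<close>, extended by
    \<open>0\<close> to all \<open>j\<close>. They tend to \<open>\<kappa> * s j\<close> under the
    summable majorant \<open>4 * B * s j\<close>, as Tannery's theorem requires.\<close>
  define g where "g j n = (if j < n \<and> 2 * j \<le> n then b (n - j) / r n * s j else 0)" for j n
  have head_lim: "(\<lambda>n. \<Sum>j. g j n) \<longlonglongrightarrow> (\<Sum>j. \<kappa> * s j)"
  proof -
    have g_lim: "(\<lambda>n. g j n) \<longlonglongrightarrow> \<kappa> * s j" for j
    proof -
      \<comment> \<open>The limit is taken along \<open>n + j\<close>, where the natural subtraction
        of \<open>j\<close> does not truncate, and then shifted back.\<close>
      have "(\<lambda>n. r n / r (n + j)) \<longlonglongrightarrow> 1" unfolding r_def of_nat_add by real_asymp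
      from tendsto_mult[OF lim this] have "(\<lambda>n. b n / r n * (r n / r (n + j))) \<longlonglongrightarrow> \<kappa>"
        by (simp add: r_def)
      moreover have "eventually (\<lambda>n. b n / r n * (r n / r (n + j)) = b (n + j - j) / r (n + j)) at_top"
        using eventually_gt_at_top[of 0]
      proof eventually_elim
        case (elim n)
        then show ?case using r_pos[OF elim] by simp
      qed
      ultimately have "(\<lambda>n. b (n + j - j) / r (n + j)) \<longlonglongrightarrow> \<kappa>" by (rule Lim_transform_eventually)
      then have "(\<lambda>n. b (n - j) / r n) \<longlonglongrightarrow> \<kappa>" by (rule LIMSEQ_offset)
      from tendsto_mult[OF this tendsto_const] have "(\<lambda>n. b (n - j) / r n * s j) \<longlonglongrightarrow> \<kappa> * s j" .
      moreover have "eventually (\<lambda>n. b (n - j) / r n * s j = g j n) at_top"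
        using eventually_gt_at_top[of "2 * j"] by eventually_elim (auto simp: g_def)
      ultimately show ?thesis by (rule Lim_transform_eventually)
    qed
    have "norm (g j n) \<le> 4 * B * s j" for j n
    proof (cases "j < n \<and> 2 * j \<le> n")
      case True
      then have n: "0 < n" "0 < n - j" "n \<le> 2 * (n - j)" by auto
      have "b (n - j) \<le> B * r (n - j)" using B n by auto
      also have "\<dots> \<le> B * (4 * r n)" using r_half n B_pos by (intro mult_left_mono) auto
      finally have "b (n - j) / r n \<le> 4 * B" using r_pos[OF n(1)] by (simp add: field_simps)
      then have "b (n - j) / r n * s j \<le> 4 * B * s j" by (rule mult_right_mono[OF _ s_nonneg])
      moreover have "0 \<le> b (n - j) / r n * s j" using b_nonneg s_nonneg r_pos[OF n(1)] by simp
      moreover have "g j n = b (n - j) / r n * s j" using True by (simp add: g_def)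
      ultimately show ?thesis by (simp only: real_norm_def abs_of_nonneg)
    qed (use B_pos s_nonneg in \<open>auto simp: g_def\<close>)
    then have "eventually (\<lambda>(j, n). norm (g j n) \<le> 4 * B * s j) (at_top \<times>\<^sub>F sequentially)"
      by (intro always_eventually) auto
    from tannerys_theorem[OF g_lim this summable_mult[OF s_summable] sequentially_bot]
    show ?thesis by blast
  qed
  have g_sum: "(\<Sum>j. g j n) = (\<Sum>j | j < n \<and> 2 * j \<le> n. b (n - j) * s j) / r n" for n
  proof -
    have "(\<Sum>j. g j n) = (\<Sum>j | j < n \<and> 2 * j \<le> n. g j n)"
      by (rule suminf_finite) (auto simp: g_def)
    then show ?thesis by (simp add: g_def sum_divide_distrib)
  qed
  have tail_lim: "(\<lambda>n. real n * s n / r n - (\<Sum>j. g j n)) \<longlonglongrightarrow> 0"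
  proof (rule tendsto_sandwich)
    have tail_eq: "real n * s n / r n - (\<Sum>j. g j n) = (\<Sum>j | j < n \<and> n < 2 * j. b (n - j) * s j) / r n" if "0 < n" for n
      using split[OF that] by (simp add: g_sum add_divide_distrib)
    show "eventually (\<lambda>n. 0 \<le> real n * s n / r n - (\<Sum>j. g j n)) sequentially"
      using eventually_gt_at_top[of 0]
    proof eventually_elim
      case (elim n)
      then show ?case
        unfolding tail_eq[OF elim] using b_nonneg s_nonneg r_pos[OF elim] by (intro divide_nonneg_pos sum_nonneg) auto
    qed
    show "eventually (\<lambda>n. real n * s n / r n - (\<Sum>j. g j n) \<le> 8 * C * \<beta> / real n) sequentially"
      using eventually_gt_at_top[of 0]
    proof eventually_elim
      case (elim n)
      have "(\<Sum>j | j < n \<and> n < 2 * j. b (n - j) * s j) \<le> 8 * C * \<beta> * r n / real n"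
        using s_le C_pos elim by (intro tail) auto
      then show ?case
        unfolding tail_eq[OF elim] using r_pos[OF elim] by (simp add: field_simps)
    qed
  qed (auto intro: tendsto_const_over_n)
  have "(\<lambda>n. real n * s n / r n) \<longlonglongrightarrow> \<kappa> * E"
    using tendsto_add[OF tail_lim head_lim] suminf_mult[OF s_summable] sum_s by simp
  then show "(\<lambda>n. real n * s n / real n powr (-3/2)) \<longlonglongrightarrow> \<kappa> * exp (\<Sum>k. b k / real k)"
    by (simp add: r_def E_def)
qed

section \<open>Central binomial coefficients\<close>

text \<open>From \<open>n\<close> to \<open>n + 1\<close> the product gains
  \<open>(2 * n + 2)^2 / ((2 * n + 1) * (2 * n + 3))\<close>, while the normalized coefficient gains
  \<open>(2 * n + 1) / (2 * n + 2)\<close>; with the linear factor these cancel. Wallis's product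
  thus gives the limit of \<open>n\<close> times the squared coefficient.\<close>

lemma wallis_central_binomial:
  "(\<Prod>k=1..n. (4 * real k ^ 2) / (4 * real k ^ 2 - 1)) * (2 * real n + 1) * (real (2 * n choose n) / 4 ^ n) ^ 2 = 1"
proof (induction n)
  case (Suc n)
  define P where "P = (\<Prod>k=1..n. (4 * real k ^ 2) / (4 * real k ^ 2 - 1))"
  define c where "c n = real (2 * n choose n) / 4 ^ n" for n
  define x where "x = real (2 * Suc n choose Suc n)"
  have "real (Suc n) * x = 2 * (2 * real n + 1) * real (2 * n choose n)"
  proof -
    have "Suc n * (2 * Suc n choose Suc n) = 2 * ((2 * n + 1) * (2 * n choose n))"
    proof -
      have "Suc n * (Suc (2 * n + 1) choose Suc n) = Suc (2 * n + 1) * (2 * n + 1 choose n)"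
        by (rule Suc_times_binomial)
      moreover have "(n + 1) * (2 * n + 1 choose n) = (2 * n + 1) * (2 * n choose n)"
        using binomial_absorb_comp[of "2 * n + 1" n] by simp
      ultimately show ?thesis by (simp add: algebra_simps)
    qed
    from arg_cong[OF this, of real] show ?thesis by (simp add: x_def algebra_simps del: binomial_Suc_Suc)
  qed
  then have c: "c (Suc n) = c n * (2 * real n + 1) / (2 * real n + 2)"
  proof -
    have "c (Suc n) = x / 4 ^ Suc n" by (simp only: c_def x_def)
    also have "x = 2 * (2 * real n + 1) * real (2 * n choose n) / real (Suc n)"
      using \<open>real (Suc n) * x = _\<close> by (simp add: field_simps)
    also have "2 * (2 * real n + 1) * y / real (Suc n) / 4 ^ Suc n =
        y / 4 ^ n * (2 * real n + 1) / (2 * real n + 2)" for y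
    proof -
      have "real (Suc n) * 4 ^ Suc n = 2 * (4 ^ n * (2 * real n + 2))" by (simp add: algebra_simps)
      then have "2 * (2 * real n + 1) * y / real (Suc n) / 4 ^ Suc n =
          (2 * (y * (2 * real n + 1))) / (2 * (4 ^ n * (2 * real n + 2)))"
        by (simp only: divide_divide_eq_left mult_ac)
      also have "\<dots> = (y * (2 * real n + 1)) / (4 ^ n * (2 * real n + 2))"
        by (rule mult_divide_mult_cancel_left) simp
      finally show ?thesis by simp
    qed
    finally show ?thesis by (simp only: c_def)
  qed
  have IH: "P * (2 * real n + 1) * c n ^ 2 = 1" using Suc by (simp add: P_def c_def)
  have "(\<Prod>k=1..Suc n. (4 * real k ^ 2) / (4 * real k ^ 2 - 1)) =
      P * ((2 * real n + 2) ^ 2 / ((2 * real n + 1) * (2 * real n + 3)))"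
    by (simp add: P_def) (simp add: algebra_simps power2_eq_square)
  then have "(\<Prod>k=1..Suc n. (4 * real k ^ 2) / (4 * real k ^ 2 - 1)) * (2 * real (Suc n) + 1) * c (Suc n) ^ 2
      = P * ((2 * real n + 2) ^ 2 / ((2 * real n + 1) * (2 * real n + 3))) * (2 * real n + 3) *
        (c n * (2 * real n + 1) / (2 * real n + 2)) ^ 2"
    by (simp add: c algebra_simps)
  also have "\<dots> = P * (2 * real n + 1) * c n ^ 2"
  proof -
    have "2 * real n + 1 \<noteq> 0" "2 * real n + 2 \<noteq> 0" "2 * real n + 3 \<noteq> 0" by linarith+
    then show ?thesis by (simp add: divide_simps power2_eq_square)
  qed
  also note IH
  finally show ?case by (simp only: c_def)
qed simp

lemma central_binomial_tendsto:
  "(\<lambda>n. sqrt (real n) * (real (2 * n choose n) / 4 ^ n)) \<longlonglongrightarrow> 1 / sqrt pi"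
proof -
  define c where "c n = real (2 * n choose n) / 4 ^ n" for n
  define P where "P n = (\<Prod>k=1..n. (4 * real k ^ 2) / (4 * real k ^ 2 - 1))" for n
  have "P n * ((2 * real n + 1) * c n ^ 2) = 1" for n
    using wallis_central_binomial[of n] by (simp add: P_def c_def mult.assoc)
  then have "1 / P n = (2 * real n + 1) * c n ^ 2" for n
    by (metis mult_eq_0_iff nonzero_mult_div_cancel_left one_neq_zero)
  moreover have "(\<lambda>n. 1 / P n) \<longlonglongrightarrow> 1 / (pi / 2)"
    using tendsto_divide[OF tendsto_const wallis, of 1] by (simp add: P_def)
  ultimately have "(\<lambda>n. (2 * real n + 1) * c n ^ 2) \<longlonglongrightarrow> 2 / pi" by simp
  moreover have "(\<lambda>n. real n / (2 * real n + 1)) \<longlonglongrightarrow> 1 / 2" by real_asymp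
  ultimately have "(\<lambda>n. (2 * real n + 1) * c n ^ 2 * (real n / (2 * real n + 1))) \<longlonglongrightarrow> 2 / pi * (1 / 2)"
    by (rule tendsto_mult)
  moreover have "(2 * real n + 1) * c n ^ 2 * (real n / (2 * real n + 1)) = real n * c n ^ 2" for n
  proof -
    have "2 * real n + 1 \<noteq> 0" by linarith
    then show ?thesis by (simp add: field_simps)
  qed
  ultimately have "(\<lambda>n. real n * c n ^ 2) \<longlonglongrightarrow> 2 / pi * (1 / 2)" by (simp only:)
  then have "(\<lambda>n. real n * c n ^ 2) \<longlonglongrightarrow> 1 / pi" by simp
  then have "(\<lambda>n. sqrt (real n * c n ^ 2)) \<longlonglongrightarrow> sqrt (1 / pi)" by (rule tendsto_real_sqrt)
  moreover have "0 \<le> c n" for n by (simp add: c_def)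
  ultimately show ?thesis by (simp add: real_sqrt_mult real_sqrt_divide c_def)
qed

section \<open>Asymptotics of N and conclusion\<close>

text \<open>\<open>N\<close> is meant for positive arguments only, so the value at \<open>0\<close>
  is fixed to \<open>0\<close>.\<close>

definition scaled_N :: "nat \<Rightarrow> real" where
  "scaled_N n = (if n = 0 then 0 else real (N n) / 4 ^ n)"

lemma N_le: "N n \<le> 4 ^ n"
proof -
  have "N n \<le> card (Pow {1..2 * n - 1})"
    unfolding N_def by (rule card_mono) auto
  also have "\<dots> = 2 ^ (2 * n - 1)" by (simp add: card_Pow)
  also have "\<dots> \<le> 2 ^ (2 * n)" by (rule power_increasing) auto
  finally show ?thesis by (simp add: power_mult)
qed

lemma normalized_recurrence:
  "real n * (real (S n) / 4 ^ n) = (\<Sum>j<n. scaled_N (n - j) * (real (S j) / 4 ^ j))"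
proof -
  have "n * S n = (\<Sum>j<n. N (n - j) * S j)"
    unfolding score_sequence_recurrence
    by (rule sum.reindex_bij_witness[of _ "\<lambda>j. n - j" "\<lambda>k. n - k"]) auto
  then have "real n * real (S n) = (\<Sum>j<n. real (N (n - j)) * real (S j))"
    by (simp flip: of_nat_mult of_nat_sum)
  then have "real n * (real (S n) / 4 ^ n) = (\<Sum>j<n. real (N (n - j)) * real (S j) / 4 ^ n)"
    by (simp add: sum_divide_distrib)
  also have "\<dots> = (\<Sum>j<n. scaled_N (n - j) * (real (S j) / 4 ^ j))"
    by (intro sum.cong) (auto simp: scaled_N_def simp flip: power_add)
  finally show ?thesis .
qed

text \<open>Dividing \<open>N_approx\<close> by \<open>4 ^ n\<close> leaves half the central
  binomial term with an exponentially small error, which survives multiplication by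
  \<open>n powr (3/2)\<close>.\<close>

lemma scaled_N_tendsto: "(\<lambda>n. scaled_N n / real n powr (-3/2)) \<longlonglongrightarrow> 1 / (2 * sqrt pi)"
proof -
  define c where "c n = real (2 * n choose n) / 4 ^ n" for n
  have "(\<lambda>n. scaled_N n / real n powr (-3/2) - sqrt (real n) * c n / 2) \<longlonglongrightarrow> 0"
  proof (rule Lim_null_comparison)
    show "eventually (\<lambda>n. norm (scaled_N n / real n powr (-3/2) - sqrt (real n) * c n / 2) \<le>
        sqrt (real n) / 2 * (real n / 2 ^ n)) sequentially"
      using eventually_gt_at_top[of 0]
    proof eventually_elim
      case (elim n)
      have "real n powr (3/2) = real n powr (1 + 1/2)" by simp
      also have "\<dots> = real n * sqrt (real n)" using elim by (simp only: powr_add powr_half_sqrt) simp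
      finally have "scaled_N n / real n powr (-3/2) = real n * sqrt (real n) * (real (N n) / 4 ^ n)"
        using elim by (simp add: scaled_N_def powr_minus field_simps)
      then have "scaled_N n / real n powr (-3/2) - sqrt (real n) * c n / 2 =
          sqrt (real n) / 2 * ((2 * (real n * real (N n)) - real (2 * n choose n)) / 4 ^ n)"
        by (simp add: c_def diff_divide_distrib right_diff_distrib mult_ac)
      also have "norm \<dots> = sqrt (real n) / 2 * (\<bar>2 * (real n * real (N n)) - real (2 * n choose n)\<bar> / 4 ^ n)"
        by (simp add: abs_mult)
      also have "\<dots> \<le> sqrt (real n) / 2 * (real n * 2 ^ n / 4 ^ n)"
        using N_approx[OF elim] by (intro mult_left_mono divide_right_mono) auto
      also have "real n * 2 ^ n / 4 ^ n = real n / 2 ^ n"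
        using power_mult_distrib[of "2 :: real" 2 n] by simp
      finally show ?case .
    qed
    show "(\<lambda>n. sqrt (real n) / 2 * (real n / 2 ^ n)) \<longlonglongrightarrow> 0" by real_asymp
  qed
  moreover have "(\<lambda>n. sqrt (real n) * c n / 2) \<longlonglongrightarrow> 1 / sqrt pi / 2"
    unfolding c_def by (intro tendsto_divide central_binomial_tendsto tendsto_const) auto
  ultimately have "(\<lambda>n. (scaled_N n / real n powr (-3/2) - sqrt (real n) * c n / 2) + sqrt (real n) * c n / 2)
      \<longlonglongrightarrow> 0 + 1 / sqrt pi / 2" by (rule tendsto_add)
  then show ?thesis by (simp add: mult.commute)
qed

theorem theorem1p1:
  shows "summable (\<lambda>k. real (N (Suc k)) / (real (Suc k) * 4 ^ Suc k)) \<and>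
    (\<lambda>n. real (S n)) \<sim>[at_top]
      (\<lambda>n. real (N n) / real n *
            exp (\<Sum>k. real (N (Suc k)) / (real (Suc k) * 4 ^ Suc k)))"
proof -
  define s where "s n = real (S n) / 4 ^ n" for n
  define \<kappa> where "\<kappa> = 1 / (2 * sqrt pi)"
  have \<kappa>: "0 < \<kappa>" by (simp add: \<kappa>_def)
  have "real (N n) \<le> 4 ^ n" for n
    using N_le[of n] by (metis of_nat_le_iff of_nat_numeral of_nat_power)
  then have b: "0 \<le> scaled_N n" "scaled_N n \<le> 1" for n
    by (auto simp: scaled_N_def)
  have s0: "s 0 = 1" by (simp add: s_def S_0)
  note asymp = log_convolution_asymptotics[of s scaled_N \<kappa>, OF s0 normalized_recurrence[folded s_def] b
      scaled_N_tendsto[folded \<kappa>_def]]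
  have b_Suc: "scaled_N (Suc k) / real (Suc k) = real (N (Suc k)) / (real (Suc k) * 4 ^ Suc k)" for k
    by (simp only: scaled_N_def) (simp add: mult_ac)
  have summable: "summable (\<lambda>k. real (N (Suc k)) / (real (Suc k) * 4 ^ Suc k))"
    using asymp(1) summable_Suc_iff[of "\<lambda>k. scaled_N k / real k"] by (simp only: b_Suc)
  define E where "E = exp (\<Sum>k. real (N (Suc k)) / (real (Suc k) * 4 ^ Suc k))"
  \<comment> \<open>The term at \<open>0\<close> vanishes, so the series may start at
    \<open>Suc k\<close>.\<close>
  have "exp (\<Sum>k. scaled_N k / real k) = E"
    using suminf_split_head[OF asymp(1)] by (simp only: b_Suc E_def) (simp add: scaled_N_def)
  with asymp(2) have num: "(\<lambda>n. real n * s n / real n powr (-3/2)) \<longlonglongrightarrow> \<kappa> * E" by simp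
  have E: "0 < E" by (simp add: E_def)
  have "(\<lambda>n. scaled_N n / real n powr (-3/2) * E) \<longlonglongrightarrow> \<kappa> * E"
    unfolding \<kappa>_def by (intro tendsto_mult scaled_N_tendsto tendsto_const)
  \<comment> \<open>Numerator and denominator share the positive limit \<open>\<kappa> * E\<close>;
    in their quotient the powers of \<open>n\<close> and \<open>4\<close> cancel.\<close>
  then have "(\<lambda>n. (real n * s n / real n powr (-3/2)) / (scaled_N n / real n powr (-3/2) * E)) \<longlonglongrightarrow> (\<kappa> * E) / (\<kappa> * E)"
    using \<kappa> E by (intro tendsto_divide num) auto
  then have "(\<lambda>n. (real n * s n / real n powr (-3/2)) / (scaled_N n / real n powr (-3/2) * E)) \<longlonglongrightarrow> 1"
    using \<kappa> E by simp
  moreover have "eventually (\<lambda>n. (real n * s n / real n powr (-3/2)) / (scaled_N n / real n powr (-3/2) * E) =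
      real (S n) / (real (N n) / real n * E)) at_top"
    using eventually_gt_at_top[of 0]
  proof eventually_elim
    case (elim n)
    then show ?case by (simp add: scaled_N_def s_def mult_ac)
  qed
  ultimately have "(\<lambda>n. real (S n) / (real (N n) / real n * E)) \<longlonglongrightarrow> 1"
    by (rule Lim_transform_eventually)
  then have "(\<lambda>n. real (S n)) \<sim>[at_top] (\<lambda>n. real (N n) / real n * E)"
    by (rule asymp_equivI')
  with summable show ?thesis by (simp only: E_def)
qed

end
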